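(* Let $d\ge3$ and $1\le k\le\lfloor (d-1)/2\rfloor$. Let $\mu=\mu_1+\mu_2$ be a finite measure on $\mathbb{R}^d$, where $\mu_1$ is the ($k$-dimensional) area measure on a nonempty open subset of a smooth $k$-dimensional submanifold of $\mathbb{R}^d$, and $\mu_2$ is the ($(d-1)$-dimensional) area measure on a nonempty open subset $\Omega$ of a smooth hypersurface in $\mathbb{R}^d$ such that $\Omega$ contains a point at which the Gaussian curvature is non-zero. Then $L^2(\mu)$ does not admit a Fourier frame.
   Context: "Smooth" means $C^\infty$; the area measure is the surface (Hausdorff) measure induced by the embedding in $\mathbb{R}^d$, and the measures are assumed finite. For $\lambda\in\mathbb{R}^d$, $e_\lambda(x)=e^{2\pi i\langle\lambda,x\rangle}$. A countable $\Lambda\subset\mathbb{R}^d$ gives a Fourier frame $E(\Lambda)=\{e_\lambda\}_{\lambda\in\Lambda}$ for $L^2(\mu)$ if there are $0<A,B<\infty$ with $A\|f\|^2_{L^2(\mu)}\le\sum_{\lambda\in\Lambda}|\langle f,e_\lambda\rangle_{L^2(\mu)}|^2\le B\|f\|^2_{L^2(\mu)}$ for all $f\in L^2(\mu)$; "$L^2(\mu)$ admits a Fourier frame" means such a $\Lambda$ exists. *)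

theory Defs
  imports "HOL-Analysis.Analysis"
begin

fun Cn_on :: "nat \<Rightarrow> 'k::euclidean_space set \<Rightarrow> ('k \<Rightarrow> 'b::real_normed_vector) \<Rightarrow> bool" where
  "Cn_on 0 S f = continuous_on S f"
| "Cn_on (Suc n) S f =
     (\<exists>f'. (\<forall>x\<in>S. (f has_derivative f' x) (at x)) \<and> (\<forall>v. Cn_on n S (\<lambda>x. f' x v)))"

definition smooth_on :: "'k::euclidean_space set \<Rightarrow> ('k \<Rightarrow> 'b::real_normed_vector) \<Rightarrow> bool" where
  "smooth_on S f \<longleftrightarrow> (\<forall>n. Cn_on n S f)"

definition local_param :: "('k::euclidean_space \<Rightarrow> 'a::euclidean_space) \<Rightarrow> 'k set \<Rightarrow> 'a set \<Rightarrow> 'a set \<Rightarrow> bool" where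
  "local_param \<phi> U V M \<longleftrightarrow>
     open U \<and> open V \<and> smooth_on U \<phi> \<and> \<phi> ` U = M \<inter> V \<and> inj_on \<phi> U \<and>
     continuous_on (M \<inter> V) (inv_into U \<phi>) \<and>
     (\<forall>u\<in>U. inj (frechet_derivative \<phi> (at u)))"

definition smooth_submanifold :: "'k::euclidean_space itself \<Rightarrow> 'a::euclidean_space set \<Rightarrow> bool" where
  "smooth_submanifold (_::'k itself) M \<longleftrightarrow>
     (\<forall>p\<in>M. \<exists>(\<phi>::'k \<Rightarrow> 'a) U V. p \<in> V \<and> local_param \<phi> U V M)"

definition det_form :: "('k::euclidean_space \<Rightarrow> 'k \<Rightarrow> real) \<Rightarrow> real" where
  "det_form B = (\<Sum>p | p permutes (Basis::'k set). of_int (sign p) * (\<Prod>i\<in>Basis. B i (p i)))"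

text \<open>Gaussian curvature computed in a chart \<phi> at parameter u with unit normal N:
  det(second fundamental form) / det(first fundamental form).\<close>
definition gauss_curvature_chart :: "('k::euclidean_space \<Rightarrow> 'a::euclidean_space) \<Rightarrow> 'k \<Rightarrow> 'a \<Rightarrow> real" where
  "gauss_curvature_chart \<phi> u N =
     det_form (\<lambda>i j. frechet_derivative (\<lambda>x. frechet_derivative \<phi> (at x) j) (at u) i \<bullet> N) /
     det_form (\<lambda>i j. frechet_derivative \<phi> (at u) i \<bullet> frechet_derivative \<phi> (at u) j)"

text \<open>The Gaussian curvature of the hypersurface M (charts from 'k, DIM('k) = DIM('a) - 1)
  at the point p is non-zero.\<close>
definition nonzero_gauss_curvature_at :: "'k::euclidean_space itself \<Rightarrow> 'a::euclidean_space set \<Rightarrow> 'a \<Rightarrow> bool" where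
  "nonzero_gauss_curvature_at (_::'k itself) M p \<longleftrightarrow>
     (\<exists>(\<phi>::'k \<Rightarrow> 'a) U V u N. local_param \<phi> U V M \<and> u \<in> U \<and> \<phi> u = p \<and>
        norm N = 1 \<and> (\<forall>i\<in>Basis. frechet_derivative \<phi> (at u) i \<bullet> N = 0) \<and>
        gauss_curvature_chart \<phi> u N \<noteq> 0)"

definition hausdorff_const :: "real \<Rightarrow> real" where
  "hausdorff_const s = pi powr (s / 2) / Gamma (s / 2 + 1)"

definition hausdorff_outer :: "real \<Rightarrow> 'a::euclidean_space set \<Rightarrow> ennreal" where
  "hausdorff_outer s A =
     (SUP \<delta>\<in>{0<..}. INF C\<in>{C::nat \<Rightarrow> 'a set. A \<subseteq> (\<Union>i. C i) \<and> (\<forall>i. bounded (C i) \<and> diameter (C i) \<le> \<delta>)}.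
        (\<Sum>i. ennreal (hausdorff_const s * (diameter (C i) / 2) powr s)))"

definition expo :: "'a::euclidean_space \<Rightarrow> 'a \<Rightarrow> complex" where
  "expo l x = exp (2 * of_real pi * \<i> * of_real (l \<bullet> x))"

definition fourier_frame :: "'a::euclidean_space measure \<Rightarrow> 'a set \<Rightarrow> bool" where
  "fourier_frame \<mu> \<Lambda> \<longleftrightarrow> countable \<Lambda> \<and>
     (\<exists>A B. 0 < A \<and> 0 < B \<and>
       (\<forall>f::'a \<Rightarrow> complex. f \<in> borel_measurable \<mu> \<and> integrable \<mu> (\<lambda>x. (cmod (f x))\<^sup>2) \<longrightarrow>
          (let nf = (\<integral>x. (cmod (f x))\<^sup>2 \<partial>\<mu>);
               c = (\<lambda>l. (cmod (\<integral>x. f x * cnj (expo l x) \<partial>\<mu>))\<^sup>2)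
           in c summable_on \<Lambda> \<and> A * nf \<le> infsum c \<Lambda> \<and> infsum c \<Lambda> \<le> B * nf)))"

definition admits_fourier_frame :: "'a::euclidean_space measure \<Rightarrow> bool" where
  "admits_fourier_frame \<mu> \<longleftrightarrow> (\<exists>\<Lambda>. fourier_frame \<mu> \<Lambda>)"

end

theory Submission
  imports Defs
begin

text \<open>Testing the upper frame inequality on characters restricted to small balls around a point of
  \<open>\<Gamma>\<close> shows that a ball of radius \<open>r \<ge> r\<^sub>0\<close> contains at most \<open>C r\<^sup>k\<close> frequencies. Since \<open>k < d\<close>, there
  are points \<open>\<xi>\<close> arbitrarily far from all frequencies.

  Let \<open>\<nu>\<close> be the image of a bump function times Lebesgue measure under a chart of \<open>\<Omega>\<close> near the point
  of non-zero curvature. A Lipschitz estimate gives \<open>\<nu> \<le> K \<mu>\<close>, so \<open>\<nu> = h \<mu>\<close> with \<open>h\<close> bounded; in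
  particular neither the area formula nor the relative position of \<open>\<Gamma>\<close> and \<open>\<Omega>\<close> matters. With
  \<open>m = d - 1\<close>, repeated integration by parts in the squared modulus of the Fourier transform of \<open>\<nu>\<close>
  at \<open>\<eta>\<close> bounds it by \<open>C |\<eta>| powr (-3m/4)\<close>, which is weaker than the stationary phase bound but
  suffices because \<open>k \<le> m/2 < 3m/4\<close>: summing over dyadic shells around \<open>\<xi>\<close>, the frame coefficients of
  \<open>h e\<^sub>\<xi>\<close> have arbitrarily small square sum, while its norm does not depend on \<open>\<xi>\<close>.\<close>

subsection \<open>Differential preliminaries\<close>

text \<open>The two pieces pull against each other: \<open>\<Gamma>\<close> caps how many
  frequencies a shell can hold, while the modulated density on \<open>\<Omega>\<close> is almost
  invisible to frequencies far from its modulation. Once there is a point far from all frequencies,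
  the lower frame inequality has nothing left to detect the density with. The hypersurface is never
  written as a graph over its tangent plane. A chart is used directly, so the direction of the
  frequency need not be normal, and the decay proof needs an alternative: either the phase has a
  non-zero gradient at the base point, or its Hessian has no kernel. Compactness of unit spheres
  gives this alternative a single constant, which is why all estimates are made for families indexed
  by direction and shift. \<open>hausdorff_outer\<close> is only ever bounded from below, by pulling
  covers back through a chart with Lipschitz inverse. This serves both the lower density on
  \<open>\<Gamma>\<close> and the domination of \<open>\<nu>\<close>; losing a constant factor does
  no harm in either place.\<close>

lemma sum_permutes_identical_rows:
  fixes f :: "'i \<Rightarrow> 'i \<Rightarrow> real"
  assumes fin: "finite S" and ij: "i \<in> S" "j \<in> S" "i \<noteq> j" and eq: "f i = f j"
  shows "(\<Sum>p | p permutes S. of_int (sign p) * (\<Prod>l\<in>S. f l (p l))) = 0"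
proof -
  let ?t = "Transposition.transpose i j"
  have t: "?t permutes S"
    using ij by (simp add: permutes_swap_id)
  have "(\<Sum>p | p permutes S. of_int (sign p) * (\<Prod>l\<in>S. f l (p l)))
      = (\<Sum>p | p permutes S. of_int (sign (p \<circ> ?t)) * (\<Prod>l\<in>S. f l ((p \<circ> ?t) l)))"
    using sum_permutations_compose_right[OF t, of "\<lambda>p. of_int (sign p) * (\<Prod>l\<in>S. f l (p l))"] by simp
  also have "\<dots> = (\<Sum>p | p permutes S. - (of_int (sign p) * (\<Prod>l\<in>S. f l (p l))))"
  proof (rule sum.cong)
    fix p assume "p \<in> {p. p permutes S}"
    then have p: "p permutes S" by simp
    have "sign (p \<circ> ?t) = - sign p"
      using ij fin p t sign_compose[of p ?t] permutation_permutes
      by (auto simp: sign_swap_id)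
    \<comment> \<open>Rows i and j agree, so swapping the row index is invisible to the product
      while the sign flips; the sum therefore equals its own negative.\<close>
    moreover have "(\<Prod>l\<in>S. f l ((p \<circ> ?t) l)) = (\<Prod>l\<in>S. f (?t l) (p (?t l)))"
      by (rule prod.cong) (auto simp: Transposition.transpose_def eq)
    moreover have "\<dots> = (\<Prod>l\<in>S. f l (p l))"
      using prod.permute[OF t, of "\<lambda>l. f l (p l)"] by (simp add: o_def)
    ultimately show "of_int (sign (p \<circ> ?t)) * (\<Prod>l\<in>S. f l ((p \<circ> ?t) l)) =
        - (of_int (sign p) * (\<Prod>l\<in>S. f l (p l)))"
      by simp
  qed simp
  finally show ?thesis
    by (simp add: sum_negf)
qed

text \<open>Substituting a vanishing combination of rows for row b gives determinant zero. By
  multilinearity this is the weighted sum of the determinants with row b replaced by row i, where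
  only i = b survives since the others repeat a row. Choosing b with
  \<open>w \<bullet> b \<noteq> 0\<close> forces the determinant to vanish.\<close>

lemma det_form_nonzero_imp_nondegenerate:
  fixes B :: "'k::euclidean_space \<Rightarrow> 'k \<Rightarrow> real"
  assumes det: "det_form B \<noteq> 0" and w: "w \<noteq> 0"
  shows "\<exists>j\<in>Basis. (\<Sum>i\<in>Basis. (w \<bullet> i) * B i j) \<noteq> 0"
proof (rule ccontr)
  assume "\<not> ?thesis"
  then have z: "(\<Sum>i\<in>Basis. (w \<bullet> i) * B i j) = 0" if "j \<in> Basis" for j
    using that by blast
  obtain b where b: "b \<in> Basis" "w \<bullet> b \<noteq> 0"
    using w euclidean_all_zero_iff by blast
  define R where "R i = (\<lambda>l. if l = b then B i else B l)" for i
  define d where "d i = (\<Sum>p | p permutes (Basis::'k set). of_int (sign p) * (\<Prod>l\<in>Basis. R i l (p l)))" for i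
  have pr: "(\<Prod>l\<in>Basis. R i l (p l)) = B i (p b) * (\<Prod>l\<in>Basis - {b}. B l (p l))" for i p
    using b by (subst prod.remove[of _ b]) (auto simp: R_def)
  have "(\<Sum>i\<in>Basis. (w \<bullet> i) * d i)
      = (\<Sum>p | p permutes (Basis::'k set). of_int (sign p) *
           ((\<Sum>i\<in>Basis. (w \<bullet> i) * B i (p b)) * (\<Prod>l\<in>Basis - {b}. B l (p l))))"
    unfolding d_def sum_distrib_left sum_distrib_right pr
    by (subst sum.swap) (simp add: algebra_simps)
  also have "\<dots> = 0"
    using z b permutes_in_image by (intro sum.neutral) fastforce
  finally have "(\<Sum>i\<in>Basis. (w \<bullet> i) * d i) = 0" .
  moreover have "d i = 0" if "i \<in> Basis" "i \<noteq> b" for i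
    unfolding d_def by (rule sum_permutes_identical_rows[of _ i b]) (use that b in \<open>auto simp: R_def\<close>)
  moreover have "d b = det_form B"
    unfolding d_def det_form_def R_def by (intro sum.cong prod.cong arg_cong2[where f="(*)"]) auto
  ultimately have "(w \<bullet> b) * det_form B = 0"
    using b by (subst (asm) sum.remove[of _ b]) auto
  with b det show False by simp
qed

text \<open>The derivative family inside \<open>Cn_on\<close> is only existentially quantified; this
  congruence is what allows it to be exchanged for \<open>frechet_derivative\<close>.\<close>

lemma Cn_on_cong:
  assumes "open S" "\<And>x. x \<in> S \<Longrightarrow> f x = g x" "Cn_on n S f"
  shows "Cn_on n S g"
  using assms(2,3)
proof (induction n arbitrary: f g)
  case 0
  then show ?case using continuous_on_cong by (metis Cn_on.simps(1))
next
  case (Suc n)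
  then obtain f' where f': "\<forall>x\<in>S. (f has_derivative f' x) (at x)" "\<forall>v. Cn_on n S (\<lambda>x. f' x v)"
    by auto
  have "\<forall>x\<in>S. (g has_derivative f' x) (at x)"
    using f'(1) Suc.prems(1) assms(1) has_derivative_transform_within_open by metis
  with f' show ?case by auto
qed

lemma smooth_on_has_derivative:
  assumes "smooth_on S f" "x \<in> S"
  shows "(f has_derivative frechet_derivative f (at x)) (at x)"
proof -
  have "Cn_on (Suc 0) S f" using assms(1) unfolding smooth_on_def by blast
  then show ?thesis
    using assms(2) frechet_derivative_at by fastforce
qed

lemma smooth_on_continuous_on: "smooth_on S f \<Longrightarrow> continuous_on S f"
  unfolding smooth_on_def using Cn_on.simps(1) by blast

lemma smooth_on_frechet_derivative:
  assumes "open S" "smooth_on S f"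
  shows "smooth_on S (\<lambda>x. frechet_derivative f (at x) v)"
  unfolding smooth_on_def
proof
  fix n
  obtain f' where f': "\<forall>x\<in>S. (f has_derivative f' x) (at x)" "Cn_on n S (\<lambda>x. f' x v)"
    using assms(2) unfolding smooth_on_def by (metis Cn_on.simps(2))
  show "Cn_on n S (\<lambda>x. frechet_derivative f (at x) v)"
    by (rule Cn_on_cong[OF assms(1) _ f'(2)]) (use f'(1) frechet_derivative_at in fastforce)
qed

text \<open>Bounds on basis vectors are what continuity of finitely many partial derivatives
  provides. Expanding in the basis costs the factor \<open>DIM('k)\<close>; callers that need a
  small constant compensate in their choice of \<open>C\<close>.\<close>

lemma bounded_derivative_imp_lipschitz:
  fixes f :: "'k::euclidean_space \<Rightarrow> 'b::real_normed_vector"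
  assumes der: "\<And>x. x \<in> S \<Longrightarrow> (f has_derivative f' x) (at x)" and S: "convex S"
    and bd: "\<And>x b. x \<in> S \<Longrightarrow> b \<in> Basis \<Longrightarrow> norm (f' x b) \<le> C"
    and xy: "x \<in> S" "y \<in> S"
  shows "norm (f x - f y) \<le> (C * DIM('k)) * norm (x - y)"
proof (rule differentiable_bound[OF S _ _ xy])
  fix z assume z: "z \<in> S"
  show "(f has_derivative f' z) (at z within S)"
    using der[OF z] by (rule has_derivative_at_withinI)
  have l: "linear (f' z)" using der[OF z] has_derivative_linear by blast
  show "onorm (f' z) \<le> C * DIM('k)"
  proof (rule onorm_le)
    fix v
    have "norm (f' z v) = norm (\<Sum>b\<in>Basis. (v \<bullet> b) *\<^sub>R f' z b)"
      by (subst euclidean_representation[of v, symmetric]) (simp only: linear_sum[OF l] linear_scale[OF l])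
    also have "\<dots> \<le> (\<Sum>b\<in>(Basis::'k set). norm v * C)"
      by (rule sum_norm_le) (use bd[OF z] Basis_le_norm in \<open>auto intro!: mult_mono\<close>)
    finally show "norm (f' z v) \<le> C * DIM('k) * norm v" by (simp add: algebra_simps)
  qed
qed

subsection \<open>Families of functions with uniform directional derivatives\<close>

text \<open>The bounds are uniform in the parameter \<open>x\<close>, and the class is closed under products and
  reciprocals; hence integration by parts can be iterated with constants independent of frequency
  direction and shift.\<close>

fun uniform_Cn :: "'m::euclidean_space \<Rightarrow> nat \<Rightarrow> 'x set \<Rightarrow> 'm set \<Rightarrow> ('x \<Rightarrow> 'm \<Rightarrow> real) \<Rightarrow> bool" where
  "uniform_Cn a 0 X D F \<longleftrightarrow>
     (\<exists>C. \<forall>x\<in>X. \<forall>v\<in>D. \<bar>F x v\<bar> \<le> C) \<and> (\<forall>x\<in>X. continuous_on D (F x))"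
| "uniform_Cn a (Suc n) X D F \<longleftrightarrow>
     (\<exists>C. \<forall>x\<in>X. \<forall>v\<in>D. \<bar>F x v\<bar> \<le> C) \<and> (\<forall>x\<in>X. continuous_on D (F x)) \<and>
     (\<exists>F'. (\<forall>x\<in>X. \<forall>v\<in>D. ((\<lambda>t. F x (v + t *\<^sub>R a)) has_real_derivative F' x v) (at 0)) \<and> uniform_Cn a n X D F')"

lemma uniform_Cn_bounded:
  assumes "uniform_Cn a n X D F"
  obtains C where "C > 0" "\<And>x v. x \<in> X \<Longrightarrow> v \<in> D \<Longrightarrow> \<bar>F x v\<bar> \<le> C"
proof -
  obtain C where "\<forall>x\<in>X. \<forall>v\<in>D. \<bar>F x v\<bar> \<le> C"
    using assms by (cases n) auto
  then have "\<forall>x\<in>X. \<forall>v\<in>D. \<bar>F x v\<bar> \<le> max C 1" by fastforce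
  then show ?thesis using that[of "max C 1"] by auto
qed

lemma uniform_Cn_continuous: "uniform_Cn a n X D F \<Longrightarrow> x \<in> X \<Longrightarrow> continuous_on D (F x)"
  by (cases n) auto

lemma uniform_Cn_SucI:
  assumes "\<And>x v. x \<in> X \<Longrightarrow> v \<in> D \<Longrightarrow> \<bar>F x v\<bar> \<le> C"
    and "\<And>x. x \<in> X \<Longrightarrow> continuous_on D (F x)"
    and "\<And>x v. x \<in> X \<Longrightarrow> v \<in> D \<Longrightarrow> ((\<lambda>t. F x (v + t *\<^sub>R a)) has_real_derivative F' x v) (at 0)"
    and "uniform_Cn a n X D F'"
  shows "uniform_Cn a (Suc n) X D F"
  unfolding uniform_Cn.simps using assms by blast

lemma uniform_Cn_SucE:
  assumes "uniform_Cn a (Suc n) X D F"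
  obtains F' where
    "\<And>x v. x \<in> X \<Longrightarrow> v \<in> D \<Longrightarrow> ((\<lambda>t. F x (v + t *\<^sub>R a)) has_real_derivative F' x v) (at 0)"
    "uniform_Cn a n X D F'"
  using assms unfolding uniform_Cn.simps by blast

lemma uniform_Cn_SucD: "uniform_Cn a (Suc n) X D F \<Longrightarrow> uniform_Cn a n X D F"
proof (induction n arbitrary: F)
  case (Suc n)
  from Suc.prems obtain C where C: "\<And>x v. x \<in> X \<Longrightarrow> v \<in> D \<Longrightarrow> \<bar>F x v\<bar> \<le> C"
    using uniform_Cn_bounded by metis
  from Suc.prems obtain F' where
    d: "\<And>x v. x \<in> X \<Longrightarrow> v \<in> D \<Longrightarrow> ((\<lambda>t. F x (v + t *\<^sub>R a)) has_real_derivative F' x v) (at 0)"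
    and u: "uniform_Cn a (Suc n) X D F'" by (rule uniform_Cn_SucE) (rule that)
  show ?case
    using C uniform_Cn_continuous[OF Suc.prems] d Suc.IH[OF u] by (rule uniform_Cn_SucI)
qed simp

lemma uniform_Cn_const: "uniform_Cn a n X D (\<lambda>x v. c)"
proof (induction n arbitrary: c)
  case 0
  then show ?case by (auto intro: exI[of _ "\<bar>c\<bar>"])
next
  case (Suc n)
  show ?case
    by (rule uniform_Cn_SucI[of _ _ _ "\<bar>c\<bar>" _ "\<lambda>x v. 0"]) (use Suc in auto)
qed

lemma uniform_Cn_add:
  "uniform_Cn a n X D F \<Longrightarrow> uniform_Cn a n X D G \<Longrightarrow> uniform_Cn a n X D (\<lambda>x v. F x v + G x v)"
proof (induction n arbitrary: F G)
  case 0
  from 0(1) 0(2) obtain C1 C2 where "\<forall>x\<in>X. \<forall>v\<in>D. \<bar>F x v\<bar> \<le> C1" "\<forall>x\<in>X. \<forall>v\<in>D. \<bar>G x v\<bar> \<le> C2"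
    by auto
  then have "\<forall>x\<in>X. \<forall>v\<in>D. \<bar>F x v + G x v\<bar> \<le> C1 + C2"
    by (meson abs_triangle_ineq add_mono order_trans)
  with 0 show ?case by (auto intro!: continuous_intros)
next
  case (Suc n)
  from Suc.prems obtain C1 C2 F' G' where
    b: "\<forall>x\<in>X. \<forall>v\<in>D. \<bar>F x v\<bar> \<le> C1" "\<forall>x\<in>X. \<forall>v\<in>D. \<bar>G x v\<bar> \<le> C2"
    and d: "\<forall>x\<in>X. \<forall>v\<in>D. ((\<lambda>t. F x (v + t *\<^sub>R a)) has_real_derivative F' x v) (at 0)"
      "\<forall>x\<in>X. \<forall>v\<in>D. ((\<lambda>t. G x (v + t *\<^sub>R a)) has_real_derivative G' x v) (at 0)"
    and u: "uniform_Cn a n X D F'" "uniform_Cn a n X D G'"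
    by auto
  have "\<forall>x\<in>X. \<forall>v\<in>D. \<bar>F x v + G x v\<bar> \<le> C1 + C2"
    using b by (meson abs_triangle_ineq add_mono order_trans)
  moreover have "\<forall>x\<in>X. \<forall>v\<in>D. ((\<lambda>t. F x (v + t *\<^sub>R a) + G x (v + t *\<^sub>R a)) has_real_derivative F' x v + G' x v) (at 0)"
    using d by (auto intro!: derivative_intros)
  ultimately show ?case
    using Suc.IH[OF u] uniform_Cn_continuous[OF Suc.prems(1)] uniform_Cn_continuous[OF Suc.prems(2)]
    by (intro uniform_Cn_SucI) (auto intro!: continuous_intros)
qed

lemma uniform_Cn_mult:
  "uniform_Cn a n X D F \<Longrightarrow> uniform_Cn a n X D G \<Longrightarrow> uniform_Cn a n X D (\<lambda>x v. F x v * G x v)"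
proof (induction n arbitrary: F G)
  case 0
  from 0(1) obtain C1 where 1: "C1 > 0" "\<And>x v. x\<in>X \<Longrightarrow> v\<in>D \<Longrightarrow> \<bar>F x v\<bar> \<le> C1"
    using uniform_Cn_bounded by metis
  from 0(2) obtain C2 where 2: "C2 > 0" "\<And>x v. x\<in>X \<Longrightarrow> v\<in>D \<Longrightarrow> \<bar>G x v\<bar> \<le> C2"
    using uniform_Cn_bounded by metis
  have "\<forall>x\<in>X. \<forall>v\<in>D. \<bar>F x v * G x v\<bar> \<le> C1 * C2"
    using 1 2 by (auto simp: abs_mult intro!: mult_mono)
  with 0 show ?case by (auto intro!: continuous_intros)
next
  case (Suc n)
  from Suc.prems(1) obtain C1 where 1: "C1 > 0" "\<And>x v. x\<in>X \<Longrightarrow> v\<in>D \<Longrightarrow> \<bar>F x v\<bar> \<le> C1"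
    using uniform_Cn_bounded by metis
  from Suc.prems(2) obtain C2 where 2: "C2 > 0" "\<And>x v. x\<in>X \<Longrightarrow> v\<in>D \<Longrightarrow> \<bar>G x v\<bar> \<le> C2"
    using uniform_Cn_bounded by metis
  from Suc.prems obtain F' G' where
    d: "\<forall>x\<in>X. \<forall>v\<in>D. ((\<lambda>t. F x (v + t *\<^sub>R a)) has_real_derivative F' x v) (at 0)"
      "\<forall>x\<in>X. \<forall>v\<in>D. ((\<lambda>t. G x (v + t *\<^sub>R a)) has_real_derivative G' x v) (at 0)"
    and u: "uniform_Cn a n X D F'" "uniform_Cn a n X D G'"
    by auto
  have "\<forall>x\<in>X. \<forall>v\<in>D. \<bar>F x v * G x v\<bar> \<le> C1 * C2"
    using 1 2 by (auto simp: abs_mult intro!: mult_mono)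
  moreover have "((\<lambda>t. F x (v + t *\<^sub>R a) * G x (v + t *\<^sub>R a)) has_real_derivative F' x v * G x v + F x v * G' x v) (at 0)"
    if "x \<in> X" "v \<in> D" for x v
    using DERIV_mult[OF d(1)[rule_format, OF that] d(2)[rule_format, OF that]] by (simp add: algebra_simps)
  moreover have "uniform_Cn a n X D (\<lambda>x v. F' x v * G x v + F x v * G' x v)"
    using Suc.IH u Suc.prems uniform_Cn_SucD by (intro uniform_Cn_add Suc.IH) blast+
  ultimately show ?case
    using uniform_Cn_continuous[OF Suc.prems(1)] uniform_Cn_continuous[OF Suc.prems(2)]
    by (intro uniform_Cn_SucI) (auto intro!: continuous_intros)
qed

text \<open>The lower bound has to be uniform for the reciprocals to be uniformly bounded. Higher
  orders follow because the derivative of the reciprocal is a product of \<open>F'\<close> and two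
  reciprocals, which are already in the class one order lower.\<close>

lemma uniform_Cn_inverse:
  assumes c: "c > 0" "\<And>x v. x \<in> X \<Longrightarrow> v \<in> D \<Longrightarrow> \<bar>F x v\<bar> \<ge> c"
  shows "uniform_Cn a n X D F \<Longrightarrow> uniform_Cn a n X D (\<lambda>x v. inverse (F x v))"
proof (induction n)
  case 0
  have "\<forall>x\<in>X. \<forall>v\<in>D. \<bar>inverse (F x v)\<bar> \<le> inverse c"
    using c by (auto simp: abs_inverse intro!: le_imp_inverse_le)
  moreover have "\<forall>x\<in>X. \<forall>v\<in>D. F x v \<noteq> 0" using c by fastforce
  ultimately show ?case using 0 by (auto intro!: continuous_intros)
next
  case (Suc n)
  have 1: "\<forall>x\<in>X. \<forall>v\<in>D. \<bar>inverse (F x v)\<bar> \<le> inverse c"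
    using c by (auto simp: abs_inverse intro!: le_imp_inverse_le)
  have nz: "F x v \<noteq> 0" if "x\<in>X" "v\<in>D" for x v using c that by fastforce
  from Suc.prems obtain F' where
    d: "\<forall>x\<in>X. \<forall>v\<in>D. ((\<lambda>t. F x (v + t *\<^sub>R a)) has_real_derivative F' x v) (at 0)"
    and u: "uniform_Cn a n X D F'"
    by auto
  have 2: "((\<lambda>t. inverse (F x (v + t *\<^sub>R a))) has_real_derivative
      (-1) * (F' x v * (inverse (F x v) * inverse (F x v)))) (at 0)" if "x\<in>X" "v\<in>D" for x v
    using DERIV_inverse'[OF d[rule_format, OF that]] nz[OF that] by (simp add: algebra_simps)
  have i: "uniform_Cn a n X D (\<lambda>x v. inverse (F x v))"
    using Suc uniform_Cn_SucD by blast
  have 3: "uniform_Cn a n X D (\<lambda>x v. (-1) * (F' x v * (inverse (F x v) * inverse (F x v))))"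
    by (intro uniform_Cn_mult uniform_Cn_const u i)
  have 4: "continuous_on D (\<lambda>v. inverse (F x v))" if "x \<in> X" for x
    using i that by (rule uniform_Cn_continuous)
  show ?case
    using 1[rule_format] 4 2 3 by (rule uniform_Cn_SucI)
qed

text \<open>The shift may depend on the parameter, as needed for a bump evaluated at v + w with w
  part of the index.\<close>

lemma uniform_Cn_shift:
  "uniform_Cn a n Y E F \<Longrightarrow> (\<And>x. x \<in> X \<Longrightarrow> p x \<in> Y) \<Longrightarrow> (\<And>x v. x \<in> X \<Longrightarrow> v \<in> D \<Longrightarrow> v + s x \<in> E) \<Longrightarrow>
   uniform_Cn a n X D (\<lambda>x v. F (p x) (v + s x))"
proof (induction n arbitrary: F)
  case 0
  then obtain C where "\<And>x v. x \<in> Y \<Longrightarrow> v \<in> E \<Longrightarrow> \<bar>F x v\<bar> \<le> C" using uniform_Cn_bounded by metis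
  then have 1: "\<forall>x\<in>X. \<forall>v\<in>D. \<bar>F (p x) (v + s x)\<bar> \<le> C"
    using 0 by blast
  have "continuous_on D (\<lambda>v. F (p x) (v + s x))" if "x \<in> X" for x
    by (rule continuous_on_compose2[of E "F (p x)"]) (use 0 that in \<open>auto intro!: continuous_intros\<close>)
  with 1 show ?case by auto
next
  case (Suc n)
  then obtain C where "\<And>x v. x \<in> Y \<Longrightarrow> v \<in> E \<Longrightarrow> \<bar>F x v\<bar> \<le> C" using uniform_Cn_bounded by metis
  then have 1: "\<forall>x\<in>X. \<forall>v\<in>D. \<bar>F (p x) (v + s x)\<bar> \<le> C"
    using Suc.prems by blast
  have 2: "continuous_on D (\<lambda>v. F (p x) (v + s x))" if "x \<in> X" for x
    by (rule continuous_on_compose2[of E "F (p x)"]) (use Suc.prems that in \<open>auto intro!: continuous_intros\<close>)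
  from Suc.prems obtain F' where
    d: "\<forall>x\<in>Y. \<forall>v\<in>E. ((\<lambda>t. F x (v + t *\<^sub>R a)) has_real_derivative F' x v) (at 0)"
    and u: "uniform_Cn a n Y E F'"
    by auto
  have 3: "((\<lambda>t. F (p x) (v + t *\<^sub>R a + s x)) has_real_derivative F' (p x) (v + s x)) (at 0)"
    if "x \<in> X" "v \<in> D" for x v
  proof -
    have "v + t *\<^sub>R a + s x = (v + s x) + t *\<^sub>R a" for t by (simp add: algebra_simps)
    then show ?thesis using d[rule_format, OF Suc.prems(2)[OF that(1)] Suc.prems(3)[OF that]] by (simp only:)
  qed
  show ?case
    using 1[rule_format] 2 3 Suc.IH[OF u Suc.prems(2,3)] by (rule uniform_Cn_SucI)
qed

subsection \<open>Non-stationary phase\<close>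

lemma integral_lborel_translate:
  fixes f :: "'m::euclidean_space \<Rightarrow> 'b::{banach, second_countable_topology}"
  assumes "f \<in> borel_measurable borel"
  shows "(\<integral>v. f (v + c) \<partial>lborel) = (\<integral>v. f v \<partial>lborel)"
proof -
  have "(\<integral>v. f v \<partial>lborel) = (\<integral>v. f v \<partial>(distr lborel borel ((+) c)))"
    by (simp add: lborel_distr_plus)
  also have "\<dots> = (\<integral>v. f (c + v) \<partial>lborel)"
    by (rule integral_distr) (use assms in auto)
  finally show ?thesis by (simp add: add.commute)
qed

lemma norm_integral_le_measure:
  fixes f :: "'m::euclidean_space \<Rightarrow> 'b::{banach, second_countable_topology}"
  assumes "\<And>v. norm (f v) \<le> C * indicator S v" "S \<in> sets borel" "bounded S" "C \<ge> 0"
  shows "norm (\<integral>v. f v \<partial>lborel) \<le> C * measure lborel S"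
proof -
  have fin: "emeasure lborel S < \<infinity>"
    using emeasure_bounded_finite[OF assms(3)] .
  have "norm (\<integral>v. f v \<partial>lborel) \<le> (\<integral>v. norm (f v) \<partial>lborel)"
    by (rule integral_norm_bound)
  also have "\<dots> \<le> (\<integral>v. C * indicator S v \<partial>lborel)"
    by (rule integral_mono') (use assms fin in auto)
  also have "\<dots> = C * measure lborel S"
    using assms fin by simp
  finally show ?thesis .
qed

text \<open>\<open>D\<close> and the complement of \<open>K\<close> are open and cover the space, so
  continuity can be pasted from the two.\<close>

lemma continuous_extend_zero:
  fixes f :: "'m::t2_space \<Rightarrow> 'b::real_normed_vector"
  assumes "open D" "compact K" "K \<subseteq> D" "continuous_on D f" "\<And>v. v \<in> D - K \<Longrightarrow> f v = 0"
  shows "continuous_on UNIV (\<lambda>v. if v \<in> D then f v else 0)" (is "continuous_on _ ?g")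
proof -
  have "continuous_on D ?g"
    using assms(4) by (rule continuous_on_eq) auto
  moreover have "continuous_on (- K) ?g"
    by (rule continuous_on_eq[OF continuous_on_const[of _ 0]]) (use assms in auto)
  moreover have "D \<union> - K = UNIV" using assms by auto
  moreover have "open (- K)" using compact_imp_closed[OF assms(2)] by auto
  ultimately show ?thesis
    using continuous_on_open_Un[OF assms(1)] by metis
qed

lemma integrable_lborel_compact_support:
  fixes f :: "'m::euclidean_space \<Rightarrow> 'b::{banach, second_countable_topology}"
  assumes "continuous_on UNIV f" "compact K" "\<And>v. v \<notin> K \<Longrightarrow> f v = 0"
  shows "integrable lborel f"
proof -
  have "integrable lborel (\<lambda>v. indicator K v *\<^sub>R f v)"
    using assms by (intro borel_integrable_compact) (auto intro: continuous_on_subset)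
  moreover have "(\<lambda>v. indicator K v *\<^sub>R f v) = f"
    using assms(3) by (auto simp: indicator_def fun_eq_iff)
  ultimately show ?thesis by simp
qed

text \<open>Averaging the derivative over a unit segment in direction \<open>a\<close> replaces a choice of coordinates
  adapted to \<open>a\<close>.\<close>

lemma integral_line_derivative_eq_0:
  fixes F F' :: "'m::euclidean_space \<Rightarrow> complex"
  assumes F: "continuous_on UNIV F" and F': "continuous_on UNIV F'"
    and K: "compact K" "\<And>v. v \<notin> K \<Longrightarrow> F v = 0" "\<And>v. v \<notin> K \<Longrightarrow> F' v = 0"
    and d: "\<And>v. ((\<lambda>t. F (v + t *\<^sub>R a)) has_vector_derivative F' v) (at 0)"
  shows "(\<integral>v. F' v \<partial>lborel) = 0"
proof -
  \<comment> \<open>Integrating \<open>J\<close> in t first telescopes to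
    \<open>F (v + a) - F v\<close>, whose integral is 0; integrating in v first gives the integral
    of \<open>F'\<close> for every t in the unit interval.\<close>
  define J where "J = (\<lambda>(t::real) v. indicator {0..1} t *\<^sub>R F' (v + t *\<^sub>R a))"
  have mF: "F \<in> borel_measurable borel" and mF': "F' \<in> borel_measurable borel"
    using F F' by (auto intro: borel_measurable_continuous_onI)
  have iF: "integrable lborel F" using integrable_lborel_compact_support[OF F K(1,2)] .
  obtain \<rho> where \<rho>: "K \<subseteq> cball 0 \<rho>" using compact_imp_bounded[OF K(1)] by (force simp: bounded_iff)
  have intJ: "integrable (lborel \<Otimes>\<^sub>M lborel) (case_prod J)"
  proof -
    \<comment> \<open>A point v that is moved into \<open>K\<close> by t a, with t in the unit
      interval, satisfies \<open>norm v \<le> \<rho> + norm a\<close>. So \<open>J\<close> lives on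
      this compact box, and there it is the restriction of a continuous function.\<close>
    let ?S = "{0..1::real} \<times> cball (0::'m) (\<rho> + norm a)"
    have "integrable lborel (\<lambda>p. indicator ?S p *\<^sub>R F' (snd p + fst p *\<^sub>R a))"
      by (intro borel_integrable_compact compact_Times continuous_on_compose2[OF F'] continuous_intros) auto
    moreover have "indicator ?S p *\<^sub>R F' (snd p + fst p *\<^sub>R a) = case_prod J p" for p
    proof (cases "p \<in> ?S")
      case False
      show ?thesis
      proof (cases "fst p \<in> {0..1}")
        case True
        with False have "norm (snd p) > \<rho> + norm a" by (cases p) auto
        moreover have "norm (fst p *\<^sub>R a) \<le> norm a" using True by (simp add: mult_left_le_one_le)
        ultimately have "norm (snd p + fst p *\<^sub>R a) > \<rho>"
          using norm_diff_ineq[of "snd p" "fst p *\<^sub>R a"] by linarith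
        then have "snd p + fst p *\<^sub>R a \<notin> K" using \<rho> by (auto simp: subset_iff)
        then show ?thesis using K False by (auto simp: J_def split_beta)
      qed (use False in \<open>auto simp: J_def split_beta\<close>)
    qed (auto simp: J_def split_beta)
    ultimately show ?thesis by (simp add: lborel_prod)
  qed
  have inner: "(\<integral>t. J t v \<partial>lborel) = F (v + a) - F v" for v
  proof -
    have "(\<integral>t. J t v \<partial>lborel) = F (v + 1 *\<^sub>R a) - F (v + 0 *\<^sub>R a)"
      unfolding J_def
    proof (rule integral_FTC_atLeastAtMost)
      fix t :: real
      have "((\<lambda>s. F ((v + t *\<^sub>R a) + s *\<^sub>R a)) \<circ> (\<lambda>\<tau>. \<tau> - t) has_vector_derivative 1 *\<^sub>R F' (v + t *\<^sub>R a)) (at t)"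
        by (rule vector_diff_chain_at) (use d[of "v + t *\<^sub>R a"] in \<open>auto intro!: derivative_eq_intros\<close>)
      moreover have "(\<lambda>s. F ((v + t *\<^sub>R a) + s *\<^sub>R a)) \<circ> (\<lambda>\<tau>. \<tau> - t) = (\<lambda>\<tau>. F (v + \<tau> *\<^sub>R a))"
        by (auto simp: fun_eq_iff algebra_simps)
      ultimately show "((\<lambda>\<tau>. F (v + \<tau> *\<^sub>R a)) has_vector_derivative F' (v + t *\<^sub>R a)) (at t within {0..1})"
        by (simp add: has_vector_derivative_at_within)
    qed (auto intro!: continuous_on_compose2[OF F'] continuous_intros)
    then show ?thesis by simp
  qed
  have "(\<integral>v. (\<integral>t. J t v \<partial>lborel) \<partial>lborel) = (\<integral>t. (\<integral>v. J t v \<partial>lborel) \<partial>lborel)"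
    by (rule lborel_pair.Fubini_integral[OF intJ])
  also have "\<dots> = (\<integral>t. indicator {0..1::real} t *\<^sub>R (\<integral>v. F' v \<partial>lborel) \<partial>lborel)"
    unfolding J_def using integral_lborel_translate[OF mF'] by simp
  also have "\<dots> = (\<integral>v. F' v \<partial>lborel)" by simp
  finally have "(\<integral>v. F' v \<partial>lborel) = (\<integral>v. F (v + a) - F v \<partial>lborel)"
    unfolding inner by simp
  also have "\<dots> = (\<integral>v. F (v + a) \<partial>lborel) - (\<integral>v. F v \<partial>lborel)"
  proof (rule Bochner_Integration.integral_diff)
    show "integrable lborel (\<lambda>v. F (v + a))"
    proof (rule integrable_lborel_compact_support)
      show "continuous_on UNIV (\<lambda>v. F (v + a))"
        by (auto intro!: continuous_on_compose2[OF F] continuous_intros)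
      show "compact ((\<lambda>v. v - a) ` K)"
        by (intro compact_continuous_image K continuous_intros)
      show "F (v + a) = 0" if "v \<notin> (\<lambda>v. v - a) ` K" for v
        using that K(2)[of "v + a"] by (force simp: image_iff)
    qed
  qed (rule iF)
  also have "\<dots> = 0" using integral_lborel_translate[OF mF] by simp
  finally show ?thesis .
qed

text \<open>With \<open>H\<close> the quotient of \<open>G\<close> by \<open>\<theta>'\<close>, the
  derivative of \<open>H\<close> times the exponential along \<open>a\<close> is \<open>H'\<close>
  times the exponential minus i r times the integrand. Its integral vanishes, so each step gains a
  factor 1/r and replaces \<open>G\<close> by \<open>H'\<close>, whose bounds are again uniform in
  the parameter.\<close>

lemma nonstationary_phase:
  fixes \<theta> \<theta>' G :: "'x \<Rightarrow> 'm::euclidean_space \<Rightarrow> real"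
  assumes D: "open D" "bounded D" and K: "compact K" "K \<subseteq> D"
    and \<theta>: "\<And>x. x \<in> X \<Longrightarrow> continuous_on D (\<theta> x)"
      "\<And>x v. x \<in> X \<Longrightarrow> v \<in> D \<Longrightarrow> ((\<lambda>t. \<theta> x (v + t *\<^sub>R a)) has_real_derivative \<theta>' x v) (at 0)"
    and c: "c > 0" "\<And>x v. x \<in> X \<Longrightarrow> v \<in> D \<Longrightarrow> \<bar>\<theta>' x v\<bar> \<ge> c"
  shows "uniform_Cn a n X D \<theta>' \<Longrightarrow> uniform_Cn a n X D G \<Longrightarrow> (\<And>x v. x \<in> X \<Longrightarrow> v \<in> D - K \<Longrightarrow> G x v = 0) \<Longrightarrow>
    \<exists>C>0. \<forall>x\<in>X. \<forall>r>0.
      cmod (\<integral>v. (if v \<in> D then of_real (G x v) * exp (- (\<i> * of_real (r * \<theta> x v))) else 0) \<partial>lborel) \<le> C / r ^ n"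
proof (induction n arbitrary: G)
  case 0
  obtain C where C: "C > 0" "\<And>x v. x \<in> X \<Longrightarrow> v \<in> D \<Longrightarrow> \<bar>G x v\<bar> \<le> C"
    using uniform_Cn_bounded[OF 0(2)] by metis
  have bd: "cmod (\<integral>v. (if v \<in> D then of_real (G x v) * exp (- (\<i> * of_real (r * \<theta> x v))) else 0) \<partial>lborel)
      \<le> C * measure lborel D" if "x \<in> X" for x r
    by (rule norm_integral_le_measure) (use C that D in \<open>auto simp: norm_mult norm_exp_eq_Re\<close>)
  have "cmod (\<integral>v. (if v \<in> D then of_real (G x v) * exp (- (\<i> * of_real (r * \<theta> x v))) else 0) \<partial>lborel)
      \<le> (C * measure lborel D + 1) / r ^ 0" if "x \<in> X" for x r
    by (rule order_trans[OF bd[OF that]]) simp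
  \<comment> \<open>The added 1 keeps the constant positive even if \<open>D\<close> is a null
    set.\<close>
  moreover have "C * measure lborel D + 1 > 0"
    using C by (simp add: add_nonneg_pos)
  ultimately show ?case by blast
next
  case (Suc n)
  define H where "H = (\<lambda>x v. G x v * inverse (\<theta>' x v))"
  have uH: "uniform_Cn a (Suc n) X D H"
    unfolding H_def by (intro uniform_Cn_mult uniform_Cn_inverse[OF c] Suc.prems)
  then obtain H' where
    dH: "\<And>x v. x \<in> X \<Longrightarrow> v \<in> D \<Longrightarrow> ((\<lambda>t. H x (v + t *\<^sub>R a)) has_real_derivative H' x v) (at 0)"
    and uH': "uniform_Cn a n X D H'" by (rule uniform_Cn_SucE) (rule that)
  have DK: "open (D - K)" using D K compact_imp_closed by blast
  have H0: "H x v = 0" if "x \<in> X" "v \<in> D - K" for x v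
    using Suc.prems(3)[OF that] by (simp add: H_def)
  \<comment> \<open>Since \<open>D - K\<close> is open, \<open>H\<close> vanishes on a short segment
    through v, and the derivative there is unique.\<close>
  have H'0: "H' x v = 0" if x: "x \<in> X" and v: "v \<in> D - K" for x v
  proof -
    have "((\<lambda>t. H x (v + t *\<^sub>R a)) has_real_derivative 0) (at 0)"
    proof (rule has_field_derivative_transform_within_open[of "\<lambda>_. 0"])
      show "open ((\<lambda>t::real. v + t *\<^sub>R a) -` (D - K))"
        by (intro open_vimage DK continuous_intros)
    qed (use v H0[OF x] in auto)
    then show ?thesis using DERIV_unique dH x v by blast
  qed
  obtain C where C: "C > 0" and IH: "\<And>x r. x \<in> X \<Longrightarrow> r > 0 \<Longrightarrow>
      cmod (\<integral>v. (if v \<in> D then of_real (H' x v) * exp (- (\<i> * of_real (r * \<theta> x v))) else 0) \<partial>lborel) \<le> C / r ^ n"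
    using Suc.IH[OF uniform_Cn_SucD[OF Suc.prems(1)] uH' H'0] by blast
  have "cmod (\<integral>v. (if v \<in> D then of_real (G x v) * exp (- (\<i> * of_real (r * \<theta> x v))) else 0) \<partial>lborel) \<le> C / r ^ Suc n"
    if x: "x \<in> X" and r: "r > 0" for x r
  proof -
    define e where "e v = exp (- (\<i> * of_real (r * \<theta> x v)))" for v
    define P where "P v = (if v \<in> D then of_real (H x v) * e v else 0)" for v
    define Q where "Q v = (if v \<in> D then of_real (H' x v) * e v else 0)" for v
    define S where "S v = (if v \<in> D then of_real (G x v) * e v else 0)" for v
    have ce: "continuous_on D e"
      unfolding e_def using \<theta>(1)[OF x] by (intro continuous_intros)
    have cP: "continuous_on UNIV P"
      unfolding P_def by (rule continuous_extend_zero[OF D(1) K])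
        (use ce uniform_Cn_continuous[OF uH x] H0[OF x] in \<open>auto intro!: continuous_intros\<close>)
    have cQ: "continuous_on UNIV Q"
      unfolding Q_def by (rule continuous_extend_zero[OF D(1) K])
        (use ce uniform_Cn_continuous[OF uH' x] H'0[OF x] in \<open>auto intro!: continuous_intros\<close>)
    have cS: "continuous_on UNIV S"
      unfolding S_def by (rule continuous_extend_zero[OF D(1) K])
        (use ce uniform_Cn_continuous[OF Suc.prems(2) x] Suc.prems(3)[OF x] in \<open>auto intro!: continuous_intros\<close>)
    have z: "P v = 0" "Q v = 0" "S v = 0" if "v \<notin> K" for v
      using that H0[OF x] H'0[OF x] Suc.prems(3)[OF x] by (auto simp: P_def Q_def S_def)
    \<comment> \<open>This is the product rule, with \<open>H\<close> chosen so that its product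
      with \<open>\<theta>'\<close> is \<open>G\<close>.\<close>
    have dP: "((\<lambda>t. P (v + t *\<^sub>R a)) has_vector_derivative Q v - \<i> * of_real r * S v) (at 0)" for v
    proof (cases "v \<in> D")
      case True
      have 1: "((\<lambda>t. complex_of_real (H x (v + t *\<^sub>R a))) has_vector_derivative of_real (H' x v)) (at 0)"
        using dH[OF x True] by (rule has_vector_derivative_of_real)
      have 2: "((\<lambda>t. - (\<i> * complex_of_real (r * \<theta> x (v + t *\<^sub>R a)))) has_vector_derivative - (\<i> * of_real (r * \<theta>' x v))) (at 0)"
        using \<theta>(2)[OF x True]
        by (intro has_vector_derivative_minus has_vector_derivative_mult_right has_vector_derivative_of_real DERIV_cmult)
      have 3: "((\<lambda>t. e (v + t *\<^sub>R a)) has_vector_derivative - (\<i> * of_real (r * \<theta>' x v)) * e v) (at 0)"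
        using field_vector_diff_chain_at[OF 2, of exp "e v"] DERIV_exp[of "- (\<i> * complex_of_real (r * \<theta> x v))"]
        by (simp add: e_def o_def)
      have 4: "((\<lambda>t. of_real (H x (v + t *\<^sub>R a)) * e (v + t *\<^sub>R a)) has_vector_derivative
          of_real (H x v) * (- (\<i> * of_real (r * \<theta>' x v)) * e v) + of_real (H' x v) * e v) (at 0)"
        using has_vector_derivative_mult[OF 1 3] by simp
      have nz: "\<theta>' x v \<noteq> 0" using c(1) c(2)[OF x True] by auto
      have "of_real (H x v) * (- (\<i> * of_real (r * \<theta>' x v)) * e v) + of_real (H' x v) * e v = Q v - \<i> * of_real r * S v"
        using True nz by (simp add: Q_def S_def H_def field_simps)
      with 4 have 5: "((\<lambda>t. of_real (H x (v + t *\<^sub>R a)) * e (v + t *\<^sub>R a)) has_vector_derivative Q v - \<i> * of_real r * S v) (at 0)"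
        by simp
      show ?thesis
      proof (rule has_vector_derivative_transform_within_open[OF 5])
        show "open ((\<lambda>t::real. v + t *\<^sub>R a) -` D)"
          by (intro open_vimage D continuous_intros)
      qed (use True in \<open>auto simp: P_def\<close>)
    next
      case False
      \<comment> \<open>Outside \<open>D\<close> the point lies in the open complement of
        \<open>K\<close>, where \<open>P\<close> vanishes along a short segment.\<close>
      then have vK: "v \<notin> K" using K by auto
      have "((\<lambda>t. P (v + t *\<^sub>R a)) has_vector_derivative 0) (at 0)"
      proof (rule has_vector_derivative_transform_within_open[of "\<lambda>_. 0"])
        show "open ((\<lambda>t::real. v + t *\<^sub>R a) -` (- K))"
          using compact_imp_closed[OF K(1)] by (intro open_vimage continuous_intros) auto
      qed (use vK z in auto)
      then show ?thesis using z[OF vK] by simp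
    qed
    have "0 = (\<integral>v. Q v - \<i> * of_real r * S v \<partial>lborel)"
      by (rule integral_line_derivative_eq_0[symmetric, OF cP _ K(1) _ _ dP])
        (use z cQ cS in \<open>auto intro!: continuous_intros\<close>)
    also have "\<dots> = (\<integral>v. Q v \<partial>lborel) - \<i> * of_real r * (\<integral>v. S v \<partial>lborel)"
      using integrable_lborel_compact_support[OF cQ K(1) z(2)] integrable_lborel_compact_support[OF cS K(1) z(3)]
      by (subst Bochner_Integration.integral_diff) auto
    finally have "(\<integral>v. Q v \<partial>lborel) = \<i> * of_real r * (\<integral>v. S v \<partial>lborel)" by simp
    then have "r * cmod (\<integral>v. S v \<partial>lborel) = cmod (\<integral>v. Q v \<partial>lborel)"
      using r by (simp add: norm_mult)
    also have "\<dots> \<le> C / r ^ n"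
      using IH[OF x r] unfolding Q_def e_def .
    finally have "cmod (\<integral>v. S v \<partial>lborel) \<le> C / r ^ Suc n"
      using r by (simp add: field_simps)
    then show ?thesis unfolding S_def e_def .
  qed
  with C show ?case by blast
qed

section \<open>Smooth maps and their difference quotients as uniform families\<close>

lemma smooth_on_line_derivative:
  assumes "smooth_on U f" "v \<in> U"
  shows "((\<lambda>t. \<omega> \<bullet> f (v + t *\<^sub>R a)) has_real_derivative \<omega> \<bullet> frechet_derivative f (at v) a) (at 0)"
proof -
  let ?D = "frechet_derivative f (at v)"
  have fd: "(f has_derivative ?D) (at v)"
    using smooth_on_has_derivative[OF assms] .
  have "((\<lambda>t. v + t *\<^sub>R a) has_derivative (\<lambda>t. t *\<^sub>R a)) (at (0::real))"
    by (auto intro!: derivative_eq_intros)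
  then have "((\<lambda>t. f (v + t *\<^sub>R a)) has_derivative (\<lambda>t. ?D (t *\<^sub>R a))) (at 0)"
    using has_derivative_compose[of "\<lambda>t. v + t *\<^sub>R a" "\<lambda>t. t *\<^sub>R a" 0 UNIV f ?D] fd by simp
  then have "((\<lambda>t. \<omega> \<bullet> f (v + t *\<^sub>R a)) has_derivative (\<lambda>t. \<omega> \<bullet> ?D (t *\<^sub>R a))) (at 0)"
    by (rule has_derivative_inner_right)
  moreover have "(\<lambda>t. \<omega> \<bullet> ?D (t *\<^sub>R a)) = (*) (\<omega> \<bullet> ?D a)"
    using linear_scale[OF has_derivative_linear[OF fd]] by (auto simp: fun_eq_iff)
  ultimately show ?thesis by (simp add: has_field_derivative_def)
qed

lemma smooth_on_lipschitz:
  fixes f :: "'k::euclidean_space \<Rightarrow> 'b::real_normed_vector"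
  assumes U: "open U" "smooth_on U f" and C: "compact C" "convex C" "C \<subseteq> U"
  obtains L where "L > 0" "\<And>x y. x \<in> C \<Longrightarrow> y \<in> C \<Longrightarrow> norm (f x - f y) \<le> L * norm (x - y)"
proof -
  have "\<exists>B. \<forall>x\<in>C. norm (frechet_derivative f (at x) b) \<le> B" for b
  proof -
    have "continuous_on C (\<lambda>x. frechet_derivative f (at x) b)"
      using smooth_on_continuous_on[OF smooth_on_frechet_derivative[OF U]] C continuous_on_subset by blast
    then show ?thesis
      using compact_imp_bounded[OF compact_continuous_image[OF _ C(1)]] by (fastforce simp: bounded_iff)
  qed
  then obtain B where B: "\<And>x b. x \<in> C \<Longrightarrow> norm (frechet_derivative f (at x) b) \<le> B b" by metis
  define B' where "B' = (\<Sum>b\<in>Basis. \<bar>B b\<bar>)"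
  have B': "norm (frechet_derivative f (at x) b) \<le> B'" if "x \<in> C" "b \<in> Basis" for x b
  proof -
    have "B b \<le> \<bar>B b\<bar>" by simp
    also have "\<dots> \<le> B'" unfolding B'_def using that by (intro member_le_sum) auto
    finally show ?thesis using B[OF that(1), of b] by simp
  qed
  have "norm (f x - f y) \<le> (\<bar>B' * DIM('k)\<bar> + 1) * norm (x - y)" if "x \<in> C" "y \<in> C" for x y
  proof -
    have "norm (f x - f y) \<le> (B' * DIM('k)) * norm (x - y)"
      by (rule bounded_derivative_imp_lipschitz[OF _ C(2) B' that])
        (use smooth_on_has_derivative[OF U(2)] C in auto)
    also have "\<dots> \<le> (\<bar>B' * DIM('k)\<bar> + 1) * norm (x - y)"
      by (intro mult_right_mono) auto
    finally show ?thesis .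
  qed
  then show ?thesis using that[of "\<bar>B' * DIM('k)\<bar> + 1"] by simp
qed

text \<open>Pairing with a unit vector keeps bounds by Cauchy-Schwarz, and differentiation along
  \<open>a\<close> only replaces \<open>f\<close> by a partial derivative; hence the induction is
  over all smooth \<open>f\<close> at once.\<close>

lemma uniform_Cn_smooth:
  fixes f :: "'m::euclidean_space \<Rightarrow> 'a::euclidean_space"
  assumes U: "open U" and C: "compact C" "C \<subseteq> U" "D \<subseteq> C" and X: "\<And>\<omega>. \<omega> \<in> X \<Longrightarrow> norm \<omega> = 1"
  shows "smooth_on U f \<Longrightarrow> uniform_Cn a n X D (\<lambda>\<omega> v. \<omega> \<bullet> f v)"
proof (induction n arbitrary: f)
  case 0
  have c: "continuous_on U f" using smooth_on_continuous_on[OF 0] .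
  then have "continuous_on C f" "continuous_on D f" using C continuous_on_subset by blast+
  moreover obtain B where B: "\<And>v. v \<in> C \<Longrightarrow> norm (f v) \<le> B"
    using compact_imp_bounded[OF compact_continuous_image[OF \<open>continuous_on C f\<close> C(1)]]
    by (auto simp: bounded_iff)
  have "\<bar>\<omega> \<bullet> f v\<bar> \<le> B" if "\<omega> \<in> X" "v \<in> D" for \<omega> v
    using Cauchy_Schwarz_ineq2[of \<omega> "f v"] X[OF that(1)] B[of v] C that by force
  ultimately show ?case by (auto intro!: continuous_intros)
next
  case (Suc n)
  have c: "continuous_on U f" using smooth_on_continuous_on[OF Suc.prems] .
  then have cC: "continuous_on C f" and cD: "continuous_on D f" using C continuous_on_subset by blast+
  obtain B where B: "\<And>v. v \<in> C \<Longrightarrow> norm (f v) \<le> B"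
    using compact_imp_bounded[OF compact_continuous_image[OF cC C(1)]]
    by (auto simp: bounded_iff)
  have "\<bar>\<omega> \<bullet> f v\<bar> \<le> B" if "\<omega> \<in> X" "v \<in> D" for \<omega> v
    using Cauchy_Schwarz_ineq2[of \<omega> "f v"] X[OF that(1)] B[of v] C that by force
  moreover have "((\<lambda>t. \<omega> \<bullet> f (v + t *\<^sub>R a)) has_real_derivative \<omega> \<bullet> frechet_derivative f (at v) a) (at 0)"
    if "v \<in> D" for \<omega> v
    using smooth_on_line_derivative[OF Suc.prems] that C by blast
  moreover have "uniform_Cn a n X D (\<lambda>\<omega> v. \<omega> \<bullet> frechet_derivative f (at v) a)"
    by (rule Suc.IH[OF smooth_on_frechet_derivative[OF U Suc.prems]])
  ultimately show ?case
    using cD by (intro uniform_Cn_SucI) (auto intro!: continuous_intros)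
qed

text \<open>The point is uniformity as the shift tends to 0: division by its norm is paid for by the
  Lipschitz estimate on the convex set \<open>C\<close>. Differentiation along \<open>a\<close>
  commutes with differencing, so the derivative is the same quotient formed from a partial
  derivative of \<open>f\<close>.\<close>

lemma uniform_Cn_smooth_difference:
  fixes f :: "'m::euclidean_space \<Rightarrow> 'a::euclidean_space"
  assumes U: "open U" and C: "compact C" "convex C" "C \<subseteq> U" "D \<subseteq> C"
    and X: "\<And>w \<omega>. (w, \<omega>) \<in> X \<Longrightarrow> w \<noteq> 0 \<and> norm \<omega> = 1" "\<And>w \<omega> v. (w, \<omega>) \<in> X \<Longrightarrow> v \<in> D \<Longrightarrow> v + w \<in> C"
  shows "smooth_on U f \<Longrightarrow> uniform_Cn a n X D (\<lambda>x v. (snd x \<bullet> f (v + fst x) - snd x \<bullet> f v) / norm (fst x))"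
proof (induction n arbitrary: f)
  case (0 f)
  have c: "continuous_on U f" using smooth_on_continuous_on[OF 0] .
  obtain L where L: "L > 0" "\<And>x y. x \<in> C \<Longrightarrow> y \<in> C \<Longrightarrow> norm (f x - f y) \<le> L * norm (x - y)"
    using smooth_on_lipschitz[OF U 0 C(1-3)] by metis
  have bd: "\<bar>(snd x \<bullet> f (v + fst x) - snd x \<bullet> f v) / norm (fst x)\<bar> \<le> L" if "x \<in> X" "v \<in> D" for x v
  proof -
    have x: "norm (snd x) = 1" "fst x \<noteq> 0" "v + fst x \<in> C" "v \<in> C"
      using X[of "fst x" "snd x"] C that by auto
    have "\<bar>snd x \<bullet> (f (v + fst x) - f v)\<bar> \<le> L * norm (fst x)"
      using Cauchy_Schwarz_ineq2[of "snd x" "f (v + fst x) - f v"] L(2)[OF x(3,4)] x by simp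
    then show ?thesis using x by (simp add: inner_diff_right divide_le_eq)
  qed
  have c2: "continuous_on D (\<lambda>v. f (v + fst x))" if "x \<in> X" for x
    by (rule continuous_on_compose2[OF c]) (use X(2)[of "fst x" "snd x"] that C in \<open>auto intro!: continuous_intros\<close>)
  have c3: "continuous_on D f" using c C continuous_on_subset by blast
  have "continuous_on D (\<lambda>v. (snd x \<bullet> f (v + fst x) - snd x \<bullet> f v) / norm (fst x))" if "x \<in> X" for x
    using c2[OF that] c3 X(1)[of "fst x" "snd x"] that by (auto intro!: continuous_intros)
  with bd show ?case unfolding uniform_Cn.simps by blast
next
  case (Suc n f)
  have c: "continuous_on U f" using smooth_on_continuous_on[OF Suc.prems] .
  obtain L where L: "L > 0" "\<And>x y. x \<in> C \<Longrightarrow> y \<in> C \<Longrightarrow> norm (f x - f y) \<le> L * norm (x - y)"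
    using smooth_on_lipschitz[OF U Suc.prems C(1-3)] by metis
  have 1: "\<bar>(snd x \<bullet> f (v + fst x) - snd x \<bullet> f v) / norm (fst x)\<bar> \<le> L" if "x \<in> X" "v \<in> D" for x v
  proof -
    have x: "norm (snd x) = 1" "fst x \<noteq> 0" "v + fst x \<in> C" "v \<in> C"
      using X[of "fst x" "snd x"] C that by auto
    have "\<bar>snd x \<bullet> (f (v + fst x) - f v)\<bar> \<le> L * norm (fst x)"
      using Cauchy_Schwarz_ineq2[of "snd x" "f (v + fst x) - f v"] L(2)[OF x(3,4)] x by simp
    then show ?thesis using x by (simp add: inner_diff_right divide_le_eq)
  qed
  have 2: "continuous_on D (\<lambda>v. f (v + fst x))" if "x \<in> X" for x
    by (rule continuous_on_compose2[OF c]) (use X(2)[of "fst x" "snd x"] that C in \<open>auto intro!: continuous_intros\<close>)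
  have 3: "continuous_on D f" using c C continuous_on_subset by blast
  have 4: "continuous_on D (\<lambda>v. (snd x \<bullet> f (v + fst x) - snd x \<bullet> f v) / norm (fst x))" if "x \<in> X" for x
    using 2[OF that] 3 X(1)[of "fst x" "snd x"] that by (auto intro!: continuous_intros)
  have 5: "((\<lambda>t. (snd x \<bullet> f (v + t *\<^sub>R a + fst x) - snd x \<bullet> f (v + t *\<^sub>R a)) / norm (fst x)) has_real_derivative
      (snd x \<bullet> frechet_derivative f (at (v + fst x)) a - snd x \<bullet> frechet_derivative f (at v) a) / norm (fst x)) (at 0)"
    if "x \<in> X" "v \<in> D" for x v
  proof -
    have x: "v + fst x \<in> U" "v \<in> U"
      using X[of "fst x" "snd x"] C that by auto
    have "v + t *\<^sub>R a + fst x = (v + fst x) + t *\<^sub>R a" for t by (simp add: algebra_simps)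
    then show ?thesis
      using smooth_on_line_derivative[OF Suc.prems x(1), of "snd x" a] smooth_on_line_derivative[OF Suc.prems x(2), of "snd x" a]
      by (simp only:) (intro DERIV_cdivide DERIV_diff)
  qed
  show ?case
    using 1 4 5 Suc.IH[OF smooth_on_frechet_derivative[OF U Suc.prems]] by (rule uniform_Cn_SucI)
qed

section \<open>A bump function of finite smoothness\<close>

lemma DERIV_max_0_power:
  "((\<lambda>s::real. (max 0 s) ^ Suc (Suc j)) has_real_derivative real (Suc (Suc j)) * (max 0 s) ^ Suc j) (at s)"
proof -
  consider "s > 0" | "s < 0" | "s = 0" by linarith
  then show ?thesis
  proof cases
    case 1
    have "((\<lambda>s::real. s ^ Suc (Suc j)) has_real_derivative real (Suc (Suc j)) * s ^ Suc j) (at s)"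
      using DERIV_pow[of "Suc (Suc j)" s] by simp
    then have "((\<lambda>s::real. (max 0 s) ^ Suc (Suc j)) has_real_derivative real (Suc (Suc j)) * s ^ Suc j) (at s)"
      by (rule has_field_derivative_transform_within_open[where S="{0<..}"]) (use 1 in auto)
    with 1 show ?thesis by (simp add: max_def)
  next
    case 2
    have "((\<lambda>s::real. (max 0 s) ^ Suc (Suc j)) has_real_derivative 0) (at s)"
      by (rule has_field_derivative_transform_within_open[where S="{..<0}" and f="\<lambda>_. 0"]) (use 2 in auto)
    with 2 show ?thesis by (simp add: max_def)
  next
    case 3
    \<comment> \<open>Only the origin needs a limit: the difference quotient is at most |h|^(j+1),
      and this exponent is positive.\<close>
    have "((\<lambda>h::real. ((max 0 (0+h)) ^ Suc (Suc j) - (max 0 0) ^ Suc (Suc j)) / h) \<longlongrightarrow> 0) (at 0)"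
    proof (rule Lim_null_comparison)
      show "((\<lambda>h::real. \<bar>h\<bar> ^ Suc j) \<longlongrightarrow> 0) (at 0)"
        by (auto intro!: tendsto_eq_intros)
      have "norm (((max 0 (0+h)) ^ Suc (Suc j) - (max 0 0) ^ Suc (Suc j)) / h) \<le> \<bar>h\<bar> ^ Suc j" for h :: real
        by (cases "h > 0") (auto simp: max_def intro!: mult_nonpos_nonneg)
      then show "\<forall>\<^sub>F h::real in at 0. norm (((max 0 (0+h)) ^ Suc (Suc j) - (max 0 0) ^ Suc (Suc j)) / h) \<le> \<bar>h\<bar> ^ Suc j"
        by simp
    qed
    with 3 show ?thesis by (simp add: DERIV_def)
  qed
qed

text \<open>A truncated polynomial replaces a smooth bump: finitely many integrations by parts
  consume finitely many derivatives, which a large exponent \<open>j\<close> supplies in explicit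
  form.\<close>

definition bump :: "real \<Rightarrow> 'm::euclidean_space \<Rightarrow> nat \<Rightarrow> 'm \<Rightarrow> real" where
  "bump \<delta> u0 j u = (max 0 (\<delta>\<^sup>2 - (norm (u - u0))\<^sup>2)) ^ j"

lemma bump_nonneg: "bump \<delta> u0 j u \<ge> 0"
  by (simp add: bump_def)

lemma continuous_on_bump: "continuous_on S (bump \<delta> u0 j)"
  unfolding bump_def by (intro continuous_intros)

lemma bump_eq_0:
  assumes "\<delta> > 0" "j > 0" "u \<notin> ball u0 \<delta>"
  shows "bump \<delta> u0 j u = 0"
proof -
  have "\<delta> \<le> norm (u - u0)" using assms(3) by (simp add: dist_norm norm_minus_commute)
  then have "\<delta>\<^sup>2 \<le> (norm (u - u0))\<^sup>2" using assms(1) by (intro power_mono) auto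
  then show ?thesis using assms(2) by (simp add: bump_def)
qed

lemma bump_pos:
  assumes "u \<in> ball u0 \<delta>"
  shows "bump \<delta> u0 j u > 0"
proof -
  have "norm (u - u0) < \<delta>" using assms by (simp add: dist_norm norm_minus_commute)
  then have "(norm (u - u0))\<^sup>2 < \<delta>\<^sup>2" by (intro power_strict_mono) auto
  then show ?thesis by (simp add: bump_def)
qed

lemma bump_le: "bump \<delta> u0 j u \<le> (\<delta>\<^sup>2) ^ j"
  unfolding bump_def by (intro power_mono) auto

text \<open>Each differentiation lowers the exponent by one and brings out the linear factor
  \<open>(v - u0) \<bullet> a\<close>. After n of them the exponent is 1, where the bump is still
  continuous but no longer differentiable at the rim.\<close>

lemma uniform_Cn_bump:
  fixes D :: "'m::euclidean_space set"
  assumes D: "bounded D"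
  shows "uniform_Cn a n (X::'x set) D (\<lambda>_. bump \<delta> u0 (Suc n))"
proof (induction n)
  case 0
  show ?case
    using bump_le[of \<delta> u0 "Suc 0"] bump_nonneg[of \<delta> u0 "Suc 0"]
    by (auto intro!: continuous_on_bump exI[of _ "\<delta>\<^sup>2"] simp: abs_of_nonneg)
next
  case (Suc n)
  let ?q = "\<lambda>v. \<delta>\<^sup>2 - (norm (v - u0))\<^sup>2"
  \<comment> \<open>This factor is needed at every order; its derivative is the constant
    \<open>a \<bullet> a\<close>.\<close>
  have lin: "uniform_Cn a k X D (\<lambda>_ v. (v - u0) \<bullet> a)" for k
  proof -
    obtain B where B: "\<And>v. v \<in> D \<Longrightarrow> norm v \<le> B" using D by (auto simp: bounded_iff)
    have b: "\<bar>(v - u0) \<bullet> a\<bar> \<le> (B + norm u0) * norm a" if "v \<in> D" for v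
    proof -
      have "\<bar>(v - u0) \<bullet> a\<bar> \<le> norm (v - u0) * norm a" by (rule Cauchy_Schwarz_ineq2)
      also have "\<dots> \<le> (B + norm u0) * norm a"
        using norm_triangle_ineq4[of v u0] B[OF that] by (intro mult_right_mono) auto
      finally show ?thesis .
    qed
    show ?thesis
    proof (cases k)
      case 0
      then show ?thesis using b by (auto intro!: continuous_intros)
    next
      case (Suc l)
      have "((\<lambda>t. (v + t *\<^sub>R a - u0) \<bullet> a) has_real_derivative a \<bullet> a) (at 0)" for v
        by (auto intro!: derivative_eq_intros simp: inner_diff_left inner_add_left)
      then show ?thesis unfolding Suc
        using b uniform_Cn_const[of a l X D "a \<bullet> a"]
        by (intro uniform_Cn_SucI[where F'="\<lambda>_ _. a \<bullet> a"]) (auto intro!: continuous_intros)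
    qed
  qed
  have d: "((\<lambda>t. bump \<delta> u0 (Suc (Suc n)) (v + t *\<^sub>R a)) has_real_derivative
      (-2 * real (Suc (Suc n))) * (bump \<delta> u0 (Suc n) v * ((v - u0) \<bullet> a))) (at 0)" for v
  proof -
    have "((\<lambda>t. \<delta>\<^sup>2 - ((v - u0) \<bullet> (v - u0) + 2 * t * ((v - u0) \<bullet> a) + t\<^sup>2 * (a \<bullet> a))) has_real_derivative - 2 * ((v - u0) \<bullet> a)) (at 0)"
      by (auto intro!: derivative_eq_intros)
    moreover have "\<delta>\<^sup>2 - ((v - u0) \<bullet> (v - u0) + 2 * t * ((v - u0) \<bullet> a) + t\<^sup>2 * (a \<bullet> a)) = ?q (v + t *\<^sub>R a)" for t
      unfolding power2_norm_eq_inner by (simp add: inner_commute algebra_simps power2_eq_square)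
    ultimately have "((\<lambda>t. ?q (v + t *\<^sub>R a)) has_real_derivative - 2 * ((v - u0) \<bullet> a)) (at 0)"
      by simp
    from DERIV_chain2[OF _ this, of "\<lambda>s. (max 0 s) ^ Suc (Suc n)" "real (Suc (Suc n)) * (max 0 (?q v)) ^ Suc n"]
    show ?thesis
      using DERIV_max_0_power[of n "?q v"] by (simp add: bump_def algebra_simps)
  qed
  show ?case
  proof (rule uniform_Cn_SucI)
    show "\<bar>bump \<delta> u0 (Suc (Suc n)) v\<bar> \<le> (\<delta>\<^sup>2) ^ Suc (Suc n)" for v
      using bump_le[of \<delta> u0 "Suc (Suc n)"] bump_nonneg[of \<delta> u0 "Suc (Suc n)"] by (auto simp: abs_of_nonneg)
    show "uniform_Cn a n X D (\<lambda>x v. (-2 * real (Suc (Suc n))) * (bump \<delta> u0 (Suc n) v * ((v - u0) \<bullet> a)))"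
      by (intro uniform_Cn_mult uniform_Cn_const Suc lin)
  qed (rule continuous_on_bump d)+
qed

text \<open>Taking the squared modulus replaces the phase by its difference quotient, whose gradient is
  controlled from below by the Hessian.\<close>

lemma norm_integral_square_le:
  fixes F :: "'m::euclidean_space \<Rightarrow> complex"
  assumes F: "continuous_on UNIV F" and K: "compact K" "\<And>v. v \<notin> K \<Longrightarrow> F v = 0"
    and b: "integrable lborel b" "\<And>w. cmod (\<integral>v. F (v + w) * cnj (F v) \<partial>lborel) \<le> b w"
  shows "(cmod (\<integral>v. F v \<partial>lborel))\<^sup>2 \<le> (\<integral>w. b w \<partial>lborel)"
proof -
  have mF: "F \<in> borel_measurable borel"
    using F by (auto intro: borel_measurable_continuous_onI)
  let ?I = "\<integral>v. F v \<partial>lborel"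
  \<comment> \<open>A non-zero integrand puts both v and v + w in \<open>K\<close>, hence w in the
    difference set.\<close>
  let ?S = "{x - y | x y. x \<in> K \<and> y \<in> K} \<times> K"
  have int: "integrable (lborel \<Otimes>\<^sub>M lborel) (\<lambda>(w, v). F (v + w) * cnj (F v))"
    unfolding lborel_prod
  proof (rule integrable_lborel_compact_support)
    show "continuous_on UNIV (\<lambda>(w, v). F (v + w) * cnj (F v))"
      unfolding split_beta
      by (intro continuous_intros continuous_on_compose2[OF F]) auto
    show "compact ?S"
      by (intro compact_Times compact_differences K)
    show "(case p of (w, v) \<Rightarrow> F (v + w) * cnj (F v)) = 0" if "p \<notin> ?S" for p
    proof (cases p)
      case (Pair w v)
      show ?thesis
      proof (rule ccontr)
        assume "\<not> ?thesis"
        then have "v \<in> K" "v + w \<in> K" using K(2) Pair by auto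
        moreover from this have "w \<in> {x - y | x y. x \<in> K \<and> y \<in> K}"
          by (intro CollectI exI[of _ "v + w"] exI[of _ v]) auto
        ultimately have "p \<in> ?S" unfolding Pair by blast
        with that show False by simp
      qed
    qed
  qed
  \<comment> \<open>Translating one variable of the double integral by the other turns it into an
    integral over shifts w of the autocorrelation of \<open>F\<close>.\<close>
  have "?I * cnj ?I = (\<integral>v. ?I * cnj (F v) \<partial>lborel)"
    by simp
  also have "\<dots> = (\<integral>v. (\<integral>w. F (v + w) * cnj (F v) \<partial>lborel) \<partial>lborel)"
    using integral_lborel_translate[OF mF] by (simp add: add.commute)
  also have "\<dots> = (\<integral>w. (\<integral>v. F (v + w) * cnj (F v) \<partial>lborel) \<partial>lborel)"
    by (rule lborel_pair.Fubini_integral[of "\<lambda>w v. F (v + w) * cnj (F v)"]) (use int in simp)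
  finally have "cmod (?I * cnj ?I) = cmod (\<integral>w. (\<integral>v. F (v + w) * cnj (F v) \<partial>lborel) \<partial>lborel)"
    by simp
  also have "\<dots> \<le> (\<integral>w. cmod (\<integral>v. F (v + w) * cnj (F v) \<partial>lborel) \<partial>lborel)"
    by (rule integral_norm_bound)
  also have "\<dots> \<le> (\<integral>w. b w \<partial>lborel)"
    by (rule integral_mono') (use b order_trans[OF norm_ge_zero] in auto)
  finally show ?thesis by (simp add: norm_mult power2_eq_square)
qed

text \<open>Adding up all the quantities in the alternative gives a continuous function that has no
  zero on the product of the unit spheres, so compactness bounds it away from 0.\<close>

lemma nondegenerate_uniform:
  fixes D :: "'m::euclidean_space \<Rightarrow> 'a::euclidean_space" and H :: "'m \<Rightarrow> 'm \<Rightarrow> 'a"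
  assumes lin: "\<And>a. a \<in> Basis \<Longrightarrow> linear (H a)"
    and nd: "\<And>\<omega> w. norm \<omega> = 1 \<Longrightarrow> norm w = 1 \<Longrightarrow>
      (\<exists>a\<in>Basis. \<omega> \<bullet> D a \<noteq> 0) \<or> (\<exists>a\<in>Basis. \<omega> \<bullet> H a w \<noteq> 0)"
  obtains c where "c > 0"
    "\<And>\<omega> w. norm \<omega> = 1 \<Longrightarrow> norm w = 1 \<Longrightarrow>
      (\<exists>a\<in>Basis. \<bar>\<omega> \<bullet> D a\<bar> \<ge> c) \<or> (\<exists>a\<in>Basis. \<bar>\<omega> \<bullet> H a w\<bar> \<ge> c)"
proof -
  define E where "E = (\<lambda>p. (\<Sum>a\<in>Basis. \<bar>fst p \<bullet> D a\<bar>) + (\<Sum>a\<in>Basis. \<bar>fst p \<bullet> H a (snd p)\<bar>))"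
  let ?S = "sphere (0::'a) 1 \<times> sphere (0::'m) 1"
  have "continuous_on UNIV (\<lambda>p::'a \<times> 'm. H a (snd p))" if "a \<in> Basis" for a
    by (intro continuous_on_compose2[OF linear_continuous_on[of "H a" UNIV]] continuous_intros)
      (use lin[OF that] in \<open>auto simp: linear_conv_bounded_linear\<close>)
  then have cE: "continuous_on ?S E"
    unfolding E_def by (intro continuous_intros) (auto intro: continuous_on_subset)
  have ne: "?S \<noteq> {}"
  proof -
    have "(SOME a. a \<in> Basis, SOME b. b \<in> Basis) \<in> ?S" by (simp add: SOME_Basis)
    then show ?thesis by blast
  qed
  have cS: "compact ?S" by (intro compact_Times compact_sphere)
  obtain p where p: "p \<in> ?S" "\<forall>q\<in>?S. E p \<le> E q"
    using continuous_attains_inf[OF cS ne cE] by (rule bexE) (rule that)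
  have E0: "E q \<ge> 0" for q unfolding E_def by (intro add_nonneg_nonneg sum_nonneg) auto
  have "E p \<noteq> 0"
  proof
    assume "E p = 0"
    then have "(\<Sum>a\<in>Basis. \<bar>fst p \<bullet> D a\<bar>) = 0" "(\<Sum>a\<in>Basis. \<bar>fst p \<bullet> H a (snd p)\<bar>) = 0"
      unfolding E_def by (subst (asm) add_nonneg_eq_0_iff; auto intro: sum_nonneg)+
    then have "\<forall>a\<in>Basis. fst p \<bullet> D a = 0" "\<forall>a\<in>Basis. fst p \<bullet> H a (snd p) = 0"
      by (subst (asm) sum_nonneg_eq_0_iff; auto)+
    with nd[of "fst p" "snd p"] p(1) show False by auto
  qed
  with E0[of p] have Ep: "E p > 0" by simp
  \<comment> \<open>If all 2 DIM summands were at most \<open>c\<close>, the sum would lie strictly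
    below the minimum of \<open>E\<close>; the extra 1 provides the strictness.\<close>
  define c where "c = E p / (2 * DIM('m) + 1)"
  have c: "c > 0" using Ep by (auto simp: c_def intro: divide_pos_pos)
  show ?thesis
  proof (rule that[OF c], rule ccontr)
    fix \<omega> :: 'a and w :: 'm
    assume 1: "norm \<omega> = 1" "norm w = 1"
      and "\<not> ((\<exists>a\<in>Basis. \<bar>\<omega> \<bullet> D a\<bar> \<ge> c) \<or> (\<exists>a\<in>Basis. \<bar>\<omega> \<bullet> H a w\<bar> \<ge> c))"
    then have le: "\<And>a. a \<in> Basis \<Longrightarrow> \<bar>\<omega> \<bullet> D a\<bar> \<le> c" "\<And>a. a \<in> Basis \<Longrightarrow> \<bar>\<omega> \<bullet> H a w\<bar> \<le> c"
      by force+
    have "E p \<le> E (\<omega>, w)" using 1 by (intro p(2)[rule_format]) auto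
    also have "\<dots> \<le> DIM('m) * c + DIM('m) * c"
      unfolding E_def fst_conv snd_conv by (intro add_mono sum_bounded_above le)
    also have "\<dots> < (2 * DIM('m) + 1) * c" using c by (simp add: algebra_simps)
    also have "\<dots> = E p" by (simp add: c_def)
    finally show False by simp
  qed
qed

lemma continuous_on_finite_near:
  fixes f :: "'i \<Rightarrow> 'm::metric_space \<Rightarrow> 'b::real_normed_vector"
  assumes "open U" "u0 \<in> U" "finite I" "\<And>i. i \<in> I \<Longrightarrow> continuous_on U (f i)" "e > 0"
  obtains \<delta> where "\<delta> > 0" "\<And>u i. u \<in> cball u0 \<delta> \<Longrightarrow> i \<in> I \<Longrightarrow> norm (f i u - f i u0) < e" "cball u0 \<delta> \<subseteq> U"
proof -
  have "\<forall>i\<in>I. \<forall>\<^sub>F u in nhds u0. norm (f i u - f i u0) < e"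
  proof
    fix i assume "i \<in> I"
    then have "(f i \<longlongrightarrow> f i u0) (at u0)"
      using assms continuous_on_eq_continuous_at isCont_def by blast
    then have "(f i \<longlongrightarrow> f i u0) (nhds u0)"
      by (rule tendsto_at_iff_tendsto_nhds[THEN iffD1])
    then show "\<forall>\<^sub>F u in nhds u0. norm (f i u - f i u0) < e"
      using assms(5) by (auto simp: tendsto_iff dist_norm)
  qed
  then have "\<forall>\<^sub>F u in nhds u0. \<forall>i\<in>I. norm (f i u - f i u0) < e"
    using assms(3) by (simp add: eventually_ball_finite_distrib)
  moreover have "\<forall>\<^sub>F u in nhds u0. u \<in> U"
    using assms(1,2) eventually_nhds by blast
  ultimately have "\<forall>\<^sub>F u in nhds u0. u \<in> U \<and> (\<forall>i\<in>I. norm (f i u - f i u0) < e)"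
    by (simp add: eventually_conj)
  then obtain d where d: "d > 0" "\<And>u. dist u u0 < d \<Longrightarrow> u \<in> U \<and> (\<forall>i\<in>I. norm (f i u - f i u0) < e)"
    by (auto simp: eventually_nhds_metric)
  show ?thesis
    by (rule that[of "d / 2"]) (use d in \<open>auto simp: dist_commute\<close>)
qed

text \<open>Dividing the phase difference by \<open>norm w\<close> makes its derivative along
  \<open>a\<close> bounded and at least \<open>c\<close> in modulus, uniformly in the shift; the
  large parameter becomes \<open>R * norm w\<close>. The radii leave room for shifting: v within
  \<open>2 * \<delta>\<close> of the centre and w of norm at most \<open>2 * \<delta>\<close> keep v
  + w inside the ball contained in \<open>U\<close>.\<close>

lemma difference_phase_decay:
  fixes \<phi> :: "'m::euclidean_space \<Rightarrow> 'a::euclidean_space"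
  assumes U: "open U" "smooth_on U \<phi>" and \<delta>: "\<delta> > 0" "cball u0 (4 * \<delta>) \<subseteq> U" and c: "c > 0"
    and X: "\<And>w \<omega>. (w, \<omega>) \<in> X \<Longrightarrow> w \<noteq> 0 \<and> norm w \<le> 2 * \<delta> \<and> norm \<omega> = 1"
    and low: "\<And>w \<omega> v. (w, \<omega>) \<in> X \<Longrightarrow> v \<in> ball u0 (2 * \<delta>) \<Longrightarrow>
      \<bar>\<omega> \<bullet> frechet_derivative \<phi> (at (v + w)) a - \<omega> \<bullet> frechet_derivative \<phi> (at v) a\<bar> \<ge> c * norm w"
  shows "\<exists>C>0. \<forall>w \<omega> R. (w, \<omega>) \<in> X \<longrightarrow> R > 0 \<longrightarrow>
    cmod (\<integral>v. (if v \<in> ball u0 (2 * \<delta>) then of_real (bump \<delta> u0 (Suc n) (v + w) * bump \<delta> u0 (Suc n) v) *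
       exp (- (\<i> * of_real (R * (\<omega> \<bullet> \<phi> (v + w) - \<omega> \<bullet> \<phi> v)))) else 0) \<partial>lborel) \<le> C / (R * norm w) ^ n"
proof -
  let ?D = "ball u0 (2 * \<delta>)" and ?C = "cball u0 (4 * \<delta>)"
  let ?\<theta> = "\<lambda>x v. (snd x \<bullet> \<phi> (v + fst x) - snd x \<bullet> \<phi> v) / norm (fst x)"
  let ?d = "\<lambda>v. frechet_derivative \<phi> (at v) a"
  let ?\<theta>' = "\<lambda>x v. (snd x \<bullet> ?d (v + fst x) - snd x \<bullet> ?d v) / norm (fst x)"
  let ?G = "\<lambda>x v. bump \<delta> u0 (Suc n) (v + fst x) * bump \<delta> u0 (Suc n) v"
  have DC: "?D \<subseteq> ?C" using \<delta> by auto
  have shift: "v + w \<in> ?C" if "(w, \<omega>) \<in> X" "v \<in> ?D" for w \<omega> v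
  proof -
    have "dist u0 (v + w) \<le> dist u0 v + norm w"
      by (metis dist_norm dist_triangle add_diff_cancel_left' norm_minus_commute)
    then show ?thesis using X[OF that(1)] that(2) by auto
  qed
  note ubd = uniform_Cn_smooth_difference[OF U(1) compact_cball convex_cball \<delta>(2) DC, of X]
  have u\<theta>: "uniform_Cn a (Suc 0) X ?D ?\<theta>"
    using ubd[OF _ _ U(2)] X shift by blast
  have u\<theta>': "uniform_Cn a n X ?D ?\<theta>'"
    using ubd[OF _ _ smooth_on_frechet_derivative[OF U]] X shift by blast
  have uG: "uniform_Cn a n X ?D ?G"
  proof (rule uniform_Cn_mult)
    \<comment> \<open>The bump itself carries no parameter, hence the one-element index type; only
      the shift varies with x.\<close>
    show "uniform_Cn a n X ?D (\<lambda>x v. bump \<delta> u0 (Suc n) (v + fst x))"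
      by (rule uniform_Cn_shift[where p="\<lambda>_. ()" and Y=UNIV and E="?C" and F="\<lambda>_. bump \<delta> u0 (Suc n)"])
        (use shift in \<open>auto intro: uniform_Cn_bump\<close>)
  qed (rule uniform_Cn_bump, simp)
  have d\<theta>: "((\<lambda>t. ?\<theta> x (v + t *\<^sub>R a)) has_real_derivative ?\<theta>' x v) (at 0)" if "x \<in> X" "v \<in> ?D" for x v
  proof -
    have x: "v + fst x \<in> U" "v \<in> U"
      using shift[of "fst x" "snd x"] \<delta> DC that by auto
    have "v + t *\<^sub>R a + fst x = (v + fst x) + t *\<^sub>R a" for t by (simp add: algebra_simps)
    then show ?thesis
      using smooth_on_line_derivative[OF U(2) x(1), of "snd x" a] smooth_on_line_derivative[OF U(2) x(2), of "snd x" a]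
      by (simp only:) (intro DERIV_cdivide DERIV_diff)
  qed
  have "\<exists>C>0. \<forall>x\<in>X. \<forall>r>0. cmod (\<integral>v. (if v \<in> ?D then of_real (?G x v) * exp (- (\<i> * of_real (r * ?\<theta> x v))) else 0) \<partial>lborel) \<le> C / r ^ n"
  proof (rule nonstationary_phase[where K="cball u0 \<delta>" and \<theta>' = ?\<theta>' and a = a and c = c])
    show "\<bar>?\<theta>' x v\<bar> \<ge> c" if "x \<in> X" "v \<in> ?D" for x v
      using low[of "fst x" "snd x" v] X[of "fst x" "snd x"] that by (simp add: le_divide_eq)
    show "?G x v = 0" if "v \<in> ?D - cball u0 \<delta>" for x v
      using bump_eq_0[of \<delta> "Suc n" v u0] that \<delta> by auto
  qed (use \<delta> c u\<theta>' uG d\<theta> uniform_Cn_continuous[OF u\<theta>] in auto)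
  then obtain C where C: "C > 0" "\<And>x r. x \<in> X \<Longrightarrow> r > 0 \<Longrightarrow> cmod (\<integral>v. (if v \<in> ?D then of_real (?G x v) * exp (- (\<i> * of_real (r * ?\<theta> x v))) else 0) \<partial>lborel) \<le> C / r ^ n"
    by blast
  show ?thesis
  proof (intro exI[of _ C] conjI allI impI C)
    fix w \<omega> and R :: real assume x: "(w, \<omega>) \<in> X" "R > 0"
    then have r: "R * norm w > 0" using X by auto
    have "(R * norm w) * ?\<theta> (w, \<omega>) v = R * (\<omega> \<bullet> \<phi> (v + w) - \<omega> \<bullet> \<phi> v)" for v
      using r by simp
    then show "cmod (\<integral>v. (if v \<in> ball u0 (2 * \<delta>) then of_real (bump \<delta> u0 (Suc n) (v + w) * bump \<delta> u0 (Suc n) v) *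
       exp (- (\<i> * of_real (R * (\<omega> \<bullet> \<phi> (v + w) - \<omega> \<bullet> \<phi> v)))) else 0) \<partial>lborel) \<le> C / (R * norm w) ^ n"
      using C(2)[OF x(1) r] by (simp only: fst_conv snd_conv)
  qed
qed

lemma gradient_phase_decay:
  fixes \<phi> :: "'m::euclidean_space \<Rightarrow> 'a::euclidean_space"
  assumes U: "open U" "smooth_on U \<phi>" and \<delta>: "\<delta> > 0" "cball u0 (4 * \<delta>) \<subseteq> U" and c: "c > 0"
    and X: "\<And>\<omega>. \<omega> \<in> X \<Longrightarrow> norm \<omega> = 1"
    and low: "\<And>\<omega> v. \<omega> \<in> X \<Longrightarrow> v \<in> ball u0 (2 * \<delta>) \<Longrightarrow> \<bar>\<omega> \<bullet> frechet_derivative \<phi> (at v) a\<bar> \<ge> c"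
  shows "\<exists>C>0. \<forall>\<omega>\<in>X. \<forall>R>0.
    cmod (\<integral>v. (if v \<in> ball u0 (2 * \<delta>) then of_real (bump \<delta> u0 (Suc n) v) *
       exp (- (\<i> * of_real (R * (\<omega> \<bullet> \<phi> v)))) else 0) \<partial>lborel) \<le> C / R ^ n"
proof -
  let ?D = "ball u0 (2 * \<delta>)" and ?C = "cball u0 (4 * \<delta>)"
  have DC: "?D \<subseteq> ?C" using \<delta> by auto
  note ubs = uniform_Cn_smooth[OF U(1) compact_cball \<delta>(2) DC X]
  have u\<theta>: "uniform_Cn a 0 X ?D (\<lambda>\<omega> v. \<omega> \<bullet> \<phi> v)"
    by (rule ubs) (auto intro: U)
  show ?thesis
  proof (rule nonstationary_phase[where K="cball u0 \<delta>" and \<theta>' = "\<lambda>\<omega> v. \<omega> \<bullet> frechet_derivative \<phi> (at v) a" and a = a and c = c])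
    show "uniform_Cn a n X ?D (\<lambda>\<omega> v. \<omega> \<bullet> frechet_derivative \<phi> (at v) a)"
      by (rule ubs) (auto intro: smooth_on_frechet_derivative U)
    show "continuous_on ?D (\<lambda>v. \<omega> \<bullet> \<phi> v)" if "\<omega> \<in> X" for \<omega>
      using uniform_Cn_continuous[OF u\<theta> that] .
    show "((\<lambda>t. \<omega> \<bullet> \<phi> (v + t *\<^sub>R a)) has_real_derivative \<omega> \<bullet> frechet_derivative \<phi> (at v) a) (at 0)" if "v \<in> ?D" for \<omega> v
      by (rule smooth_on_line_derivative[OF U(2)]) (use that \<delta> DC in blast)
    show "uniform_Cn a n X ?D (\<lambda>\<omega> v. bump \<delta> u0 (Suc n) v)"
      by (rule uniform_Cn_bump) simp
    show "bump \<delta> u0 (Suc n) v = 0" if "v \<in> ?D - cball u0 \<delta>" for v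
      using bump_eq_0[of \<delta> "Suc n" v u0] that \<delta> by auto
  qed (use \<delta> c low in auto)
qed

subsection \<open>Fourier decay under non-vanishing curvature\<close>

text \<open>If the phase in direction \<open>\<omega>\<close> has a gradient bounded below at
  \<open>u0\<close>, direct integration by parts suffices. Otherwise the Hessian in that direction
  has no kernel, so the phase difference over a shift w has, along some coordinate depending on w, a
  derivative of size at least a multiple of \<open>norm w\<close>. Integrating the resulting
  autocorrelation bound over w gives the exponent.\<close>

lemma fourier_decay:
  fixes \<phi> :: "'m::euclidean_space \<Rightarrow> 'a::euclidean_space"
  assumes U: "open U" "smooth_on U \<phi>" and u0: "u0 \<in> U" and \<delta>0: "\<delta>0 > 0"
    and nd: "\<And>\<omega> w. norm \<omega> = 1 \<Longrightarrow> norm w = 1 \<Longrightarrow>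
      (\<exists>a\<in>Basis. \<omega> \<bullet> frechet_derivative \<phi> (at u0) a \<noteq> 0) \<or>
      (\<exists>a\<in>Basis. \<omega> \<bullet> frechet_derivative (\<lambda>x. frechet_derivative \<phi> (at x) a) (at u0) w \<noteq> 0)"
  obtains \<delta> g C where "\<delta> > 0" "\<delta> \<le> \<delta>0" "cball u0 \<delta> \<subseteq> U"
    "continuous_on UNIV g" "\<And>u. g u \<ge> 0" "\<And>u. u \<in> ball u0 \<delta> \<Longrightarrow> g u > 0"
    "\<And>u. u \<notin> ball u0 \<delta> \<Longrightarrow> g u = 0" "C > 0"
    "\<And>\<eta>. norm \<eta> \<ge> 1 \<Longrightarrow>
      (cmod (\<integral>u. (if u \<in> ball u0 \<delta> then of_real (g u) * exp (- (\<i> * of_real (2 * pi * (\<eta> \<bullet> \<phi> u)))) else 0) \<partial>lborel))\<^sup>2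
        \<le> C * norm \<eta> powr (- (3 * DIM('m) / 4))"
proof -
  define d where "d = (\<lambda>a v. frechet_derivative \<phi> (at v) a)"
  define h where "h = (\<lambda>a v. frechet_derivative (d a) (at v))"
  have sd: "smooth_on U (d a)" for a
    unfolding d_def by (rule smooth_on_frechet_derivative[OF U])
  have sh: "smooth_on U (\<lambda>v. h a v b)" for a b
    unfolding h_def by (rule smooth_on_frechet_derivative[OF U(1) sd])
  have hd: "(d a has_derivative h a v) (at v)" if "v \<in> U" for a v
    unfolding h_def by (rule smooth_on_has_derivative[OF sd that])
  let ?m = "DIM('m)"
  have hl: "linear (h a u0)" for a using hd[OF u0] by (rule has_derivative_linear)
  have nd': "(\<exists>a\<in>Basis. \<omega> \<bullet> d a u0 \<noteq> 0) \<or> (\<exists>a\<in>Basis. \<omega> \<bullet> h a u0 w \<noteq> 0)"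
    if "norm \<omega> = 1" "norm w = 1" for \<omega> w
    using nd[OF that] by (simp add: d_def h_def)
  obtain c where c: "c > 0" and c': "\<And>\<omega> w. norm \<omega> = 1 \<Longrightarrow> norm w = 1 \<Longrightarrow>
      (\<exists>a\<in>Basis. \<bar>\<omega> \<bullet> d a u0\<bar> \<ge> c) \<or> (\<exists>a\<in>Basis. \<bar>\<omega> \<bullet> h a u0 w\<bar> \<ge> c)"
    by (rule nondegenerate_uniform[OF hl nd']) (assumption+, rule that)
  \<comment> \<open>This accuracy, multiplied by the factor DIM of the Lipschitz bound, adds up to
    half of \<open>c\<close>.\<close>
  define e where "e = c / (2 * ?m)"
  have e: "e > 0" "e * ?m = c / 2" "e \<le> c / 2" using c by (auto simp: e_def field_simps)
  obtain \<delta>1 where \<delta>1: "\<delta>1 > 0" "\<And>u a. u \<in> cball u0 \<delta>1 \<Longrightarrow> a \<in> Basis \<Longrightarrow> norm (d a u - d a u0) < e" "cball u0 \<delta>1 \<subseteq> U"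
    by (rule continuous_on_finite_near[of U u0 Basis d e, OF U(1) u0 _ smooth_on_continuous_on[OF sd] e(1)])
      (auto intro: that)
  obtain \<delta>2 where \<delta>2: "\<delta>2 > 0" "\<And>u p. u \<in> cball u0 \<delta>2 \<Longrightarrow> p \<in> Basis \<times> Basis \<Longrightarrow> norm (h (fst p) u (snd p) - h (fst p) u0 (snd p)) < e"
    by (rule continuous_on_finite_near[of U u0 "Basis \<times> Basis" "\<lambda>p v. h (fst p) v (snd p)" e, OF U(1) u0 _ smooth_on_continuous_on[OF sh] e(1)])
      (auto intro: that)
  define \<delta> where "\<delta> = min \<delta>0 (min \<delta>1 \<delta>2) / 4"
  have \<delta>: "\<delta> > 0" "\<delta> \<le> \<delta>0" "4 * \<delta> \<le> \<delta>1" "4 * \<delta> \<le> \<delta>2"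
    using \<delta>0 \<delta>1 \<delta>2 by (auto simp: \<delta>_def)
  have CU: "cball u0 (4 * \<delta>) \<subseteq> U" using \<delta>1(3) \<delta> by (auto simp: subset_iff)
  have near_d: "norm (d a u - d a u0) \<le> e" if "u \<in> cball u0 (4 * \<delta>)" "a \<in> Basis" for u a
    using \<delta>1(2)[of u a] that \<delta> by auto
  have near_h: "norm (h a u b - h a u0 b) \<le> e" if "u \<in> cball u0 (4 * \<delta>)" "a \<in> Basis" "b \<in> Basis" for u a b
    using \<delta>2(2)[of u "(a, b)"] that \<delta> by auto
  \<comment> \<open>Subtracting the Hessian at \<open>u0\<close> leaves a map with small derivative
    on the ball. So increments of the partial derivatives follow the linearisation up to half of the
    lower bound, for all shifts and not only small ones.\<close>
  have dif: "norm (d a u - d a v - h a u0 (u - v)) \<le> c / 2 * norm (u - v)"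
    if a: "a \<in> Basis" and uv: "u \<in> cball u0 (4 * \<delta>)" "v \<in> cball u0 (4 * \<delta>)" for a u v
  proof -
    have l: "bounded_linear (h a u0)" using hd[OF u0] has_derivative_bounded_linear by blast
    have "norm ((d a u - h a u0 u) - (d a v - h a u0 v)) \<le> (e * ?m) * norm (u - v)"
    proof (rule bounded_derivative_imp_lipschitz[where f="\<lambda>x. d a x - h a u0 x" and f'="\<lambda>x y. h a x y - h a u0 y" and S="cball u0 (4 * \<delta>)"])
      show "((\<lambda>x. d a x - h a u0 x) has_derivative (\<lambda>y. h a x y - h a u0 y)) (at x)" if "x \<in> cball u0 (4 * \<delta>)" for x
        using hd[of x a] that CU by (intro has_derivative_diff bounded_linear_imp_has_derivative l) auto
    qed (use near_h a uv in auto)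
    moreover have "(d a u - h a u0 u) - (d a v - h a u0 v) = d a u - d a v - h a u0 (u - v)"
      using linear_diff[OF hl] by simp
    ultimately show ?thesis using e(2) by simp
  qed
  \<comment> \<open>Beyond the cutoff \<open>\<rho>\<close> chosen below, R times the shift exceeds
    R^(1/4), so this power yields R^(-m).\<close>
  define n where "n = 4 * ?m"
  define g where "g = bump \<delta> u0 (Suc n)"
  \<comment> \<open>Directions and shifts are sorted by the coordinate \<open>a\<close> that
    witnesses nondegeneracy, so that one direction of differentiation serves a whole class. As there
    are finitely many classes, their constants can be dominated by \<open>K1\<close> and
    \<open>K2\<close>.\<close>
  define X1 where "X1 = (\<lambda>a. {\<omega>::'a. norm \<omega> = 1 \<and> \<bar>\<omega> \<bullet> d a u0\<bar> \<ge> c})"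
  define X2 where "X2 = (\<lambda>a. {(w::'m, \<omega>::'a). w \<noteq> 0 \<and> norm w \<le> 2 * \<delta> \<and> norm \<omega> = 1 \<and> \<bar>\<omega> \<bullet> h a u0 w\<bar> \<ge> c * norm w})"
  define P1 where "P1 = (\<lambda>a C. C > 0 \<and> (\<forall>\<omega>\<in>X1 a. \<forall>R>0.
    cmod (\<integral>v. (if v \<in> ball u0 (2 * \<delta>) then of_real (g v) *
       exp (- (\<i> * of_real (R * (\<omega> \<bullet> \<phi> v)))) else 0) \<partial>lborel) \<le> C / R ^ n))"
  define P2 where "P2 = (\<lambda>a C. C > 0 \<and> (\<forall>w \<omega> R. (w, \<omega>) \<in> X2 a \<longrightarrow> R > 0 \<longrightarrow>
    cmod (\<integral>v. (if v \<in> ball u0 (2 * \<delta>) then of_real (g (v + w) * g v) *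
       exp (- (\<i> * of_real (R * (\<omega> \<bullet> \<phi> (v + w) - \<omega> \<bullet> \<phi> v)))) else 0) \<partial>lborel) \<le> C / (R * norm w) ^ n))"
  have "\<exists>C. P1 a C" if a: "a \<in> Basis" for a
    unfolding P1_def g_def
  proof (rule gradient_phase_decay[where a = a, OF U \<delta>(1) CU, of "c / 2"])
    show "\<bar>\<omega> \<bullet> frechet_derivative \<phi> (at v) a\<bar> \<ge> c / 2" if "\<omega> \<in> X1 a" "v \<in> ball u0 (2 * \<delta>)" for \<omega> v
    proof -
      have "\<bar>\<omega> \<bullet> (d a v - d a u0)\<bar> \<le> norm \<omega> * norm (d a v - d a u0)" by (rule Cauchy_Schwarz_ineq2)
      also have "\<dots> \<le> c / 2" using near_d[OF _ a, of v] that e \<delta> by (auto simp: X1_def)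
      finally have "\<bar>\<omega> \<bullet> d a v - \<omega> \<bullet> d a u0\<bar> \<le> c / 2" by (simp add: inner_diff_right)
      moreover have "\<bar>\<omega> \<bullet> d a u0\<bar> \<ge> c" using that by (simp add: X1_def)
      ultimately have "\<bar>\<omega> \<bullet> d a v\<bar> \<ge> c / 2" by linarith
      then show ?thesis by (simp add: d_def)
    qed
  qed (use c in \<open>auto simp: X1_def\<close>)
  then have "\<forall>a\<in>Basis. \<exists>C. P1 a C" by blast
  from bchoice[OF this] obtain C1 where "\<forall>a\<in>Basis. P1 a (C1 a)" by blast
  then have C1: "\<And>a. a \<in> Basis \<Longrightarrow> C1 a > 0" "\<And>a \<omega> R. a \<in> Basis \<Longrightarrow> \<omega> \<in> X1 a \<Longrightarrow> R > 0 \<Longrightarrow>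
    cmod (\<integral>v. (if v \<in> ball u0 (2 * \<delta>) then of_real (g v) *
       exp (- (\<i> * of_real (R * (\<omega> \<bullet> \<phi> v)))) else 0) \<partial>lborel) \<le> C1 a / R ^ n"
    unfolding P1_def by blast+
  have "\<exists>C. P2 a C" if a: "a \<in> Basis" for a
    unfolding P2_def g_def
  proof (rule difference_phase_decay[where a = a, OF U \<delta>(1) CU, of "c / 2"])
    show "\<bar>\<omega> \<bullet> frechet_derivative \<phi> (at (v + w)) a - \<omega> \<bullet> frechet_derivative \<phi> (at v) a\<bar> \<ge> c / 2 * norm w"
      if x: "(w, \<omega>) \<in> X2 a" "v \<in> ball u0 (2 * \<delta>)" for w \<omega> v
    proof -
      have "dist u0 (v + w) \<le> dist u0 v + norm w"
        by (metis dist_norm dist_triangle add_diff_cancel_left' norm_minus_commute)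
      then have "v + w \<in> cball u0 (4 * \<delta>)" "v \<in> cball u0 (4 * \<delta>)" using x \<delta> by (auto simp: X2_def)
      from dif[OF a this] have "norm (d a (v + w) - d a v - h a u0 w) \<le> c / 2 * norm w" by simp
      moreover have "\<bar>\<omega> \<bullet> (d a (v + w) - d a v - h a u0 w)\<bar> \<le> norm \<omega> * norm (d a (v + w) - d a v - h a u0 w)"
        by (rule Cauchy_Schwarz_ineq2)
      ultimately have "\<bar>\<omega> \<bullet> (d a (v + w) - d a v - h a u0 w)\<bar> \<le> c / 2 * norm w"
        using x by (simp add: X2_def)
      moreover have "\<bar>\<omega> \<bullet> h a u0 w\<bar> \<ge> c * norm w" using x by (simp add: X2_def)
      ultimately have "\<bar>\<omega> \<bullet> d a (v + w) - \<omega> \<bullet> d a v\<bar> \<ge> c / 2 * norm w"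
        unfolding inner_diff_right by linarith
      then show ?thesis by (simp add: d_def)
    qed
  qed (use c in \<open>auto simp: X2_def\<close>)
  then have "\<forall>a\<in>Basis. \<exists>C. P2 a C" by blast
  from bchoice[OF this] obtain C2 where "\<forall>a\<in>Basis. P2 a (C2 a)" by blast
  then have C2: "\<And>a. a \<in> Basis \<Longrightarrow> C2 a > 0" "\<And>a w \<omega> R. a \<in> Basis \<Longrightarrow> (w, \<omega>) \<in> X2 a \<Longrightarrow> R > 0 \<Longrightarrow>
    cmod (\<integral>v. (if v \<in> ball u0 (2 * \<delta>) then of_real (g (v + w) * g v) *
       exp (- (\<i> * of_real (R * (\<omega> \<bullet> \<phi> (v + w) - \<omega> \<bullet> \<phi> v)))) else 0) \<partial>lborel) \<le> C2 a / (R * norm w) ^ n"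
    unfolding P2_def by blast+
  define K1 where "K1 = (\<Sum>a\<in>Basis. C1 a)"
  define K2 where "K2 = (\<Sum>a\<in>Basis. C2 a)"
  have K1: "C1 a \<le> K1" "K1 > 0" and K2: "C2 a \<le> K2" "K2 > 0" if "a \<in> Basis" for a
    unfolding K1_def K2_def using C1(1) C2(1) that
    by (auto intro!: member_le_sum sum_pos intro: less_imp_le)
  have K: "K1 > 0" "K2 > 0" using K1(2)[OF SOME_Basis] K2(2)[OF SOME_Basis] by auto
  have g: "continuous_on UNIV g" "\<And>u. g u \<ge> 0" "\<And>u. u \<in> ball u0 \<delta> \<Longrightarrow> g u > 0"
    "\<And>u. u \<notin> ball u0 \<delta> \<Longrightarrow> g u = 0"
    unfolding g_def using \<delta> bump_eq_0 by (auto intro: continuous_on_bump bump_nonneg bump_pos)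
  define B where "B = (\<delta>\<^sup>2) ^ Suc n"
  have gB: "g u \<le> B" for u unfolding g_def B_def by (rule bump_le)
  have B: "B \<ge> 0" unfolding B_def by simp
  define V where "V = measure lborel (cball u0 \<delta>)"
  define C0 where "C0 = B * B * V"
  have C0: "C0 \<ge> 0" using B by (simp add: C0_def V_def)
  let ?s = "3 * ?m / 4"
  let ?v = "unit_ball_vol ?m"
  \<comment> \<open>One summand for each source: the gradient case, the short shifts, and the
    remaining shifts, which fill at most a ball of radius \<open>2 * \<delta>\<close>.\<close>
  define C where "C = K1\<^sup>2 + C0 * ?v + K2 * (?v * (2 * \<delta>) ^ ?m)"
  have C: "C > 0" "K1\<^sup>2 \<le> C" "C0 * ?v + K2 * (?v * (2 * \<delta>) ^ ?m) \<le> C"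
    using K C0 \<delta> by (auto simp: C_def intro!: add_pos_nonneg)
  have "(cmod (\<integral>u. (if u \<in> ball u0 \<delta> then of_real (g u) * exp (- (\<i> * of_real (2 * pi * (\<eta> \<bullet> \<phi> u)))) else 0) \<partial>lborel))\<^sup>2
        \<le> C * norm \<eta> powr (- ?s)" if \<eta>: "norm \<eta> \<ge> 1" for \<eta>
  proof -
    define R where "R = norm \<eta>"
    define \<omega> where "\<omega> = \<eta> /\<^sub>R R"
    have R: "R \<ge> 1" using \<eta> by (simp add: R_def)
    have R0: "R \<noteq> 0" using R by simp
    then have \<omega>1: "norm \<omega> = 1" by (simp add: \<omega>_def R_def)
    have \<omega>2: "\<eta> \<bullet> y = R * (\<omega> \<bullet> y)" for y using R0 by (simp add: \<omega>_def)
    note \<omega> = \<omega>1 \<omega>2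
    define R' where "R' = 2 * pi * R"
    have R': "R' \<ge> R" "R' > 0" using R pi_gt3 by (auto simp: R'_def)
    \<comment> \<open>The cutoff sits at twice the radius so that the closed support ball of
      \<open>g\<close> lies in an open domain; the values do not change because \<open>g\<close>
      vanishes in between.\<close>
    define F where "F = (\<lambda>u. if u \<in> ball u0 (2 * \<delta>) then of_real (g u) * exp (- (\<i> * of_real (R' * (\<omega> \<bullet> \<phi> u)))) else 0)"
    have "(if u \<in> ball u0 \<delta> then of_real (g u) * exp (- (\<i> * of_real (2 * pi * (\<eta> \<bullet> \<phi> u)))) else 0) = F u" for u
    proof -
      have "R' * (\<omega> \<bullet> \<phi> u) = 2 * pi * (\<eta> \<bullet> \<phi> u)" by (simp add: R'_def \<omega>2)
      then show ?thesis
        using g(4)[of u] \<delta> unfolding F_def by (cases "u \<in> ball u0 \<delta>") auto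
    qed
    then have FI: "(\<integral>u. (if u \<in> ball u0 \<delta> then of_real (g u) * exp (- (\<i> * of_real (2 * pi * (\<eta> \<bullet> \<phi> u)))) else 0) \<partial>lborel) = (\<integral>u. F u \<partial>lborel)"
      by simp
    show ?thesis
    proof (cases "\<exists>a\<in>Basis. \<omega> \<in> X1 a")
      case True
      then obtain a where a: "a \<in> Basis" "\<omega> \<in> X1 a" by blast
      have "cmod (\<integral>u. F u \<partial>lborel) \<le> C1 a / R' ^ n"
        unfolding F_def using C1(2)[OF a R'(2)] .
      also have "\<dots> \<le> K1 / R ^ n"
        using K1[OF a(1)] R R' by (intro frac_le power_mono) auto
      finally have "(cmod (\<integral>u. F u \<partial>lborel))\<^sup>2 \<le> (K1 / R ^ n)\<^sup>2" by (intro power_mono) auto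
      also have "\<dots> = K1\<^sup>2 * R powr (- real (2 * n))"
      proof -
        have eq: "R powr (- real (2 * n)) = inverse ((R ^ n)\<^sup>2)"
          using R by (simp add: powr_minus powr_realpow power_mult[symmetric] mult.commute del: of_nat_mult)
        show ?thesis unfolding eq by (subst power_divide) (rule divide_inverse)
      qed
      also have "\<dots> \<le> C * R powr (- ?s)"
        using C R by (intro mult_mono powr_mono) (auto simp: n_def)
      finally show ?thesis unfolding FI R_def .
    next
      case False
      have X2: "\<exists>a\<in>Basis. (w, \<omega>) \<in> X2 a" if w: "w \<noteq> 0" "norm w \<le> 2 * \<delta>" for w
      proof -
        have "norm (w /\<^sub>R norm w) = 1" using w by simp
        from c'[OF \<omega>(1) this] obtain a where a: "a \<in> Basis" "\<bar>\<omega> \<bullet> h a u0 (w /\<^sub>R norm w)\<bar> \<ge> c"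
          using False \<omega>(1) by (auto simp: X1_def)
        then have "\<bar>\<omega> \<bullet> h a u0 w\<bar> \<ge> c * norm w"
          using w by (simp add: linear_scale[OF hl] abs_mult field_simps)
        then show ?thesis using a w \<omega> by (auto simp: X2_def)
      qed
      \<comment> \<open>Any exponent in \<open>(1/2, 1)\<close> would do: the ball of radius \<open>\<rho>\<close> contributes \<open>\<rho> ^ m\<close>, which must beat
        \<open>R powr (-m/2)\<close>, and outside it \<open>R * \<rho>\<close> is a positive power of \<open>R\<close>,
        of which \<open>n\<close> is chosen to take a large enough power.\<close>
      define \<rho> where "\<rho> = R powr (- (3/4))"
      have \<rho>: "\<rho> > 0" using R by (simp add: \<rho>_def)
      define b where "b = (\<lambda>w::'m. C0 * indicator (cball 0 \<rho>) w + K2 / (R * \<rho>) ^ n * indicator (cball 0 (2 * \<delta>)) w)"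
      have emc: "emeasure lborel (cball (0::'m) r) < \<infinity>" for r
        using emeasure_bounded_finite[OF bounded_cball] .
      have F0: "F u = 0" if "u \<notin> cball u0 \<delta>" for u
        using g(4)[of u] that by (auto simp: F_def)
      have FB: "cmod (F u) \<le> B * indicator (cball u0 \<delta>) u" for u
        using gB[of u] g(2)[of u] F0[of u] B by (cases "u \<in> cball u0 \<delta>") (auto simp: F_def norm_mult norm_exp_eq_Re)
      \<comment> \<open>A cutoff on v alone is enough: when v + w leaves the larger ball,
        \<open>g (v + w)\<close> is already 0.\<close>
      have FF: "F (v + w) * cnj (F v) = (if v \<in> ball u0 (2 * \<delta>) then of_real (g (v + w) * g v) *
         exp (- (\<i> * of_real (R' * (\<omega> \<bullet> \<phi> (v + w) - \<omega> \<bullet> \<phi> v)))) else 0)" for v w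
        using g(4)[of "v + w"] \<delta>
        by (auto simp: F_def exp_cnj exp_add[symmetric] algebra_simps)
      have "(cmod (\<integral>u. F u \<partial>lborel))\<^sup>2 \<le> (\<integral>w. b w \<partial>lborel)"
      proof (rule norm_integral_square_le[where K="cball u0 \<delta>"])
        show "continuous_on UNIV F"
          unfolding F_def
        proof (rule continuous_extend_zero[of _ "cball u0 \<delta>"])
          have "continuous_on (ball u0 (2 * \<delta>)) \<phi>"
            by (rule continuous_on_subset[OF smooth_on_continuous_on[OF U(2)] order_trans[OF _ CU]]) (use \<delta> in auto)
          then show "continuous_on (ball u0 (2 * \<delta>)) (\<lambda>v. of_real (g v) * exp (- (\<i> * of_real (R' * (\<omega> \<bullet> \<phi> v)))))"
            by (intro continuous_intros continuous_on_subset[OF g(1)]) auto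
        qed (use \<delta> g(4) in auto)
        show "integrable lborel b"
          unfolding b_def by (intro Bochner_Integration.integrable_add integrable_mult_right integrable_real_indicator emc) auto
        show "cmod (\<integral>v. F (v + w) * cnj (F v) \<partial>lborel) \<le> b w" for w
        proof -
          \<comment> \<open>Short shifts receive the trivial bound and intermediate ones the
            oscillation bound; beyond \<open>2 * \<delta>\<close> the supports are disjoint.\<close>
          consider "norm w \<le> \<rho>" | "norm w > \<rho>" "norm w \<le> 2 * \<delta>" | "norm w > 2 * \<delta>" by linarith
          then show ?thesis
          proof cases
            case 1
            have "cmod (\<integral>v. F (v + w) * cnj (F v) \<partial>lborel) \<le> (B * B) * measure lborel (cball u0 \<delta>)"
            proof (rule norm_integral_le_measure)
              show "cmod (F (v + w) * cnj (F v)) \<le> B * B * indicator (cball u0 \<delta>) v" for v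
                using mult_mono[OF FB[of "v + w"] FB[of v]] B
                by (cases "v \<in> cball u0 \<delta>"; cases "v + w \<in> cball u0 \<delta>") (auto simp: norm_mult F0)
            qed (use B in auto)
            also have "\<dots> \<le> b w" using 1 K R \<rho> by (simp add: b_def C0_def V_def)
            finally show ?thesis .
          next
            case 2
            then have "w \<noteq> 0" using \<rho> by auto
            then obtain a where a: "a \<in> Basis" "(w, \<omega>) \<in> X2 a" using X2 2 by blast
            have "cmod (\<integral>v. F (v + w) * cnj (F v) \<partial>lborel) \<le> C2 a / (R' * norm w) ^ n"
              unfolding FF using C2(2)[OF a R'(2)] .
            also have "\<dots> \<le> K2 / (R * \<rho>) ^ n"
              using K2[OF a(1)] R R' \<rho> 2 by (intro frac_le power_mono mult_mono) auto
            also have "\<dots> \<le> b w" using 2 C0 by (simp add: b_def)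
            finally show ?thesis .
          next
            case 3
            have z: "F (v + w) * cnj (F v) = 0" for v
            proof (rule ccontr)
              assume "\<not> ?thesis"
              then have "v \<in> cball u0 \<delta>" "v + w \<in> cball u0 \<delta>" using F0 by auto
              then have "dist (v + w) v \<le> \<delta> + \<delta>"
                using dist_triangle2[of "v + w" v u0] by (simp add: dist_commute)
              with 3 show False by (simp add: dist_norm)
            qed
            show ?thesis unfolding z using C0 K R \<rho> by (simp add: b_def)
          qed
        qed
      qed (use F0 in auto)
      also have "(\<integral>w. b w \<partial>lborel) = C0 * (?v * \<rho> ^ ?m) + K2 / (R * \<rho>) ^ n * (?v * (2 * \<delta>) ^ ?m)"
        unfolding b_def using emc \<delta> \<rho> by (subst Bochner_Integration.integral_add) (auto simp: content_cball)
      also have "\<rho> ^ ?m = R powr (- ?s)"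
        using R by (simp add: \<rho>_def powr_powr flip: powr_realpow)
      also have "K2 / (R * \<rho>) ^ n = K2 * R powr (- real ?m)"
      proof -
        have "R * \<rho> = R powr (1 / 4)" using R by (simp add: \<rho>_def powr_mult_base)
        then have "(R * \<rho>) ^ n = R powr real ?m"
          using R by (simp add: n_def powr_powr flip: powr_realpow)
        then show ?thesis by (simp add: powr_minus divide_inverse)
      qed
      also have "C0 * (?v * R powr (- ?s)) + K2 * R powr (- real ?m) * (?v * (2 * \<delta>) ^ ?m)
          \<le> C0 * (?v * R powr (- ?s)) + K2 * R powr (- ?s) * (?v * (2 * \<delta>) ^ ?m)"
        using R K \<delta> by (intro add_left_mono mult_right_mono mult_left_mono powr_mono) auto
      also have "\<dots> = (C0 * ?v + K2 * (?v * (2 * \<delta>) ^ ?m)) * R powr (- ?s)"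
        by (simp add: algebra_simps)
      also have "\<dots> \<le> C * R powr (- ?s)"
        using C by (intro mult_right_mono) auto
      finally show ?thesis unfolding FI R_def .
    qed
  qed
  moreover have "cball u0 \<delta> \<subseteq> U" using CU \<delta> by auto
  ultimately show ?thesis
    using that[OF \<delta>(1,2) _ g C(1)] by blast
qed

subsection \<open>Hausdorff measure in charts\<close>

lemma hausdorff_outer_mono:
  assumes "A \<subseteq> B"
  shows "hausdorff_outer s A \<le> hausdorff_outer s B"
  unfolding hausdorff_outer_def
proof (rule SUP_mono)
  fix \<delta> :: real assume "\<delta> \<in> {0<..}"
  then show "\<exists>m\<in>{0<..}. (INF C\<in>{C::nat \<Rightarrow> 'a set. A \<subseteq> (\<Union>i. C i) \<and> (\<forall>i. bounded (C i) \<and> diameter (C i) \<le> \<delta>)}.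
        (\<Sum>i. ennreal (hausdorff_const s * (diameter (C i) / 2) powr s)))
     \<le> (INF C\<in>{C::nat \<Rightarrow> 'a set. B \<subseteq> (\<Union>i. C i) \<and> (\<forall>i. bounded (C i) \<and> diameter (C i) \<le> m)}.
        (\<Sum>i. ennreal (hausdorff_const s * (diameter (C i) / 2) powr s)))"
    using assms by (intro bexI[of _ \<delta>] INF_superset_mono) auto
qed

text \<open>A cover of the image pulls back to balls: centre one at a point of \<open>S\<close>
  mapped into the piece, with radius \<open>L\<close> times the diameter. Its volume is (2L)^k times
  the Hausdorff weight of the piece, k being the parameter dimension, since that weight is the
  volume of a ball of half the diameter.\<close>

lemma lborel_le_hausdorff_outer_image:
  fixes \<phi> :: "'k::euclidean_space \<Rightarrow> 'a::euclidean_space"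
  assumes L: "L > 0" "\<And>u v. u \<in> S \<Longrightarrow> v \<in> S \<Longrightarrow> norm (u - v) \<le> L * norm (\<phi> u - \<phi> v)"
  shows "ennreal (1 / (2 * L) ^ DIM('k)) * emeasure lborel S \<le> hausdorff_outer (real DIM('k)) (\<phi> ` S)"
proof -
  let ?k = "DIM('k)"
  let ?c = "ennreal (1 / (2 * L) ^ ?k)"
  have "?c * emeasure lborel S \<le> (\<Sum>i. ennreal (hausdorff_const ?k * (diameter (C i) / 2) powr ?k))"
    if C: "\<phi> ` S \<subseteq> (\<Union>i. C i)" "\<And>i. bounded (C i)" for C :: "nat \<Rightarrow> 'a set"
  proof -
    define D where "D i = (if \<exists>u\<in>S. \<phi> u \<in> C i then cball (SOME u. u \<in> S \<and> \<phi> u \<in> C i) (L * diameter (C i)) else {})" for i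
    have sub: "S \<subseteq> (\<Union>i. D i)"
    proof
      fix u assume u: "u \<in> S"
      then obtain i where i: "\<phi> u \<in> C i" using C(1) by blast
      let ?u = "SOME u. u \<in> S \<and> \<phi> u \<in> C i"
      have su: "?u \<in> S \<and> \<phi> ?u \<in> C i" by (rule someI[of _ u]) (use u i in blast)
      have "norm (?u - u) \<le> L * norm (\<phi> ?u - \<phi> u)" using L(2) su u by blast
      also have "\<dots> \<le> L * diameter (C i)"
        using diameter_bounded_bound[OF C(2)[of i], of "\<phi> ?u" "\<phi> u"] su i L(1) by (auto simp: dist_norm)
      finally have "u \<in> D i" using u i by (auto simp: D_def dist_norm)
      then show "u \<in> (\<Union>i. D i)" by blast
    qed
    have mD: "range D \<subseteq> sets lborel" by (auto simp: D_def)
    have "?c * emeasure lborel S \<le> ?c * (\<Sum>i. emeasure lborel (D i))"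
      using emeasure_mono[OF sub, of lborel] emeasure_subadditive_countably[OF mD] mD
      by (intro mult_left_mono) (auto intro: order_trans)
    also have "\<dots> = (\<Sum>i. ?c * emeasure lborel (D i))" by simp
    also have "\<dots> \<le> (\<Sum>i. ennreal (hausdorff_const ?k * (diameter (C i) / 2) powr ?k))"
    proof (rule suminf_le)
      fix i
      have d: "diameter (C i) \<ge> 0" using C(2) diameter_ge_0 by blast
      have "?c * emeasure lborel (D i) \<le> ?c * ennreal (unit_ball_vol ?k * (L * diameter (C i)) ^ ?k)"
        using L d by (intro mult_left_mono) (auto simp: D_def emeasure_cball)
      also have "\<dots> = ennreal (1 / (2 * L) ^ ?k * (unit_ball_vol ?k * (L * diameter (C i)) ^ ?k))"
        using L d by (intro ennreal_mult[symmetric]) auto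
      also have "1 / (2 * L) ^ ?k * (unit_ball_vol ?k * (L * diameter (C i)) ^ ?k) = unit_ball_vol ?k * (diameter (C i) / 2) ^ ?k"
        using L by (simp add: power_mult_distrib power_divide field_simps)
      also have "\<dots> = hausdorff_const ?k * (diameter (C i) / 2) powr ?k"
        using d by (simp add: hausdorff_const_def unit_ball_vol_def powr_realpow')
      finally show "?c * emeasure lborel (D i) \<le> ennreal (hausdorff_const ?k * (diameter (C i) / 2) powr ?k)" .
    qed auto
    finally show ?thesis .
  qed
  \<comment> \<open>The estimate holds for covers of any mesh, so the single level 1 of the supremum
    is enough.\<close>
  then have "?c * emeasure lborel S \<le> (INF C\<in>{C::nat \<Rightarrow> 'a set. \<phi> ` S \<subseteq> (\<Union>i. C i) \<and> (\<forall>i. bounded (C i) \<and> diameter (C i) \<le> 1)}.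
        (\<Sum>i. ennreal (hausdorff_const ?k * (diameter (C i) / 2) powr ?k)))"
    by (intro INF_greatest) auto
  also have "\<dots> \<le> hausdorff_outer (real ?k) (\<phi> ` S)"
    unfolding hausdorff_outer_def by (rule SUP_upper) simp
  finally show ?thesis .
qed

text \<open>The derivative at \<open>u0\<close> is injective, hence bounded below by some B. On a
  ball where the difference between the chart and this derivative has Lipschitz constant B/2, half
  of the lower bound survives.\<close>

lemma local_param_bilipschitz:
  fixes \<phi> :: "'k::euclidean_space \<Rightarrow> 'a::euclidean_space"
  assumes lp: "local_param \<phi> U V M" and u0: "u0 \<in> U"
    and \<Gamma>: "openin (top_of_set M) \<Gamma>" "\<phi> u0 \<in> \<Gamma>"
  obtains \<delta> L where "\<delta> > 0" "L > 0" "cball u0 \<delta> \<subseteq> U" "\<phi> ` cball u0 \<delta> \<subseteq> \<Gamma>"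
    "\<And>u v. u \<in> cball u0 \<delta> \<Longrightarrow> v \<in> cball u0 \<delta> \<Longrightarrow> norm (u - v) \<le> L * norm (\<phi> u - \<phi> v)"
    "\<And>u v. u \<in> cball u0 \<delta> \<Longrightarrow> v \<in> cball u0 \<delta> \<Longrightarrow> norm (\<phi> u - \<phi> v) \<le> L * norm (u - v)"
proof -
  have U: "open U" "smooth_on U \<phi>" and im: "\<phi> ` U = M \<inter> V"
    and inj: "inj (frechet_derivative \<phi> (at u0))"
    using lp u0 by (auto simp: local_param_def)
  let ?D = "frechet_derivative \<phi> (at u0)"
  have D: "(\<phi> has_derivative ?D) (at u0)" using smooth_on_has_derivative[OF U(2) u0] .
  have lin: "linear ?D" and bl: "bounded_linear ?D"
    using D has_derivative_linear has_derivative_bounded_linear by blast+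
  obtain B where B: "B > 0" "\<And>x. B * norm x \<le> norm (?D x)"
    using linear_inj_bounded_below_pos[OF lin inj] by metis
  let ?k = "DIM('k)"
  define e where "e = B / (2 * ?k)"
  have e: "e > 0" "e * ?k = B / 2" using B by (auto simp: e_def)
  obtain \<delta>1 where \<delta>1: "\<delta>1 > 0"
    "\<And>u b. u \<in> cball u0 \<delta>1 \<Longrightarrow> b \<in> Basis \<Longrightarrow> norm (frechet_derivative \<phi> (at u) b - ?D b) < e" "cball u0 \<delta>1 \<subseteq> U"
    by (rule continuous_on_finite_near[of U u0 Basis "\<lambda>b u. frechet_derivative \<phi> (at u) b" e, OF U(1) u0 _
        smooth_on_continuous_on[OF smooth_on_frechet_derivative[OF U]] e(1)])
      (auto intro: that)
  obtain W where W: "open W" "\<Gamma> = M \<inter> W" using \<Gamma>(1) by (auto simp: openin_open)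
  have "open (U \<inter> \<phi> -` W)"
    using continuous_on_open_vimage[OF U(1)] smooth_on_continuous_on[OF U(2)] W(1)
    by (metis Int_commute)
  moreover have "u0 \<in> U \<inter> \<phi> -` W" using u0 \<Gamma>(2) W by auto
  ultimately obtain \<delta>2 where \<delta>2: "\<delta>2 > 0" "cball u0 \<delta>2 \<subseteq> U \<inter> \<phi> -` W"
    using open_contains_cball by blast
  define \<delta> where "\<delta> = min \<delta>1 \<delta>2"
  have \<delta>: "\<delta> > 0" "cball u0 \<delta> \<subseteq> cball u0 \<delta>1" "cball u0 \<delta> \<subseteq> cball u0 \<delta>2"
    using \<delta>1 \<delta>2 by (auto simp: \<delta>_def)
  have CU: "cball u0 \<delta> \<subseteq> U" using \<delta> \<delta>1 by blast
  have im\<Gamma>: "\<phi> ` cball u0 \<delta> \<subseteq> \<Gamma>" using \<delta>(3) \<delta>2(2) im W(2) by blast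
  obtain L' where L': "L' > 0" "\<And>x y. x \<in> cball u0 \<delta> \<Longrightarrow> y \<in> cball u0 \<delta> \<Longrightarrow> norm (\<phi> x - \<phi> y) \<le> L' * norm (x - y)"
    using smooth_on_lipschitz[OF U compact_cball convex_cball CU] by metis
  have low: "norm (u - v) \<le> 2 / B * norm (\<phi> u - \<phi> v)" if uv: "u \<in> cball u0 \<delta>" "v \<in> cball u0 \<delta>" for u v
  proof -
    have "norm ((\<phi> u - ?D u) - (\<phi> v - ?D v)) \<le> (e * ?k) * norm (u - v)"
    proof (rule bounded_derivative_imp_lipschitz[where f="\<lambda>x. \<phi> x - ?D x" and f'="\<lambda>x y. frechet_derivative \<phi> (at x) y - ?D y" and S="cball u0 \<delta>"])
      show "((\<lambda>x. \<phi> x - ?D x) has_derivative (\<lambda>y. frechet_derivative \<phi> (at x) y - ?D y)) (at x)" if "x \<in> cball u0 \<delta>" for x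
        using smooth_on_has_derivative[OF U(2), of x] that CU
        by (intro has_derivative_diff bounded_linear_imp_has_derivative bl) auto
      show "norm (frechet_derivative \<phi> (at x) b - ?D b) \<le> e" if "x \<in> cball u0 \<delta>" "b \<in> Basis" for x b
        using \<delta>1(2)[of x b] that \<delta> by auto
    qed (use uv in auto)
    moreover have "(\<phi> u - ?D u) - (\<phi> v - ?D v) = (\<phi> u - \<phi> v) - ?D (u - v)"
      using linear_diff[OF lin] by simp
    ultimately have "norm ((\<phi> u - \<phi> v) - ?D (u - v)) \<le> B / 2 * norm (u - v)"
      using e(2) by simp
    moreover have "norm (?D (u - v)) \<le> norm (\<phi> u - \<phi> v) + norm ((\<phi> u - \<phi> v) - ?D (u - v))"
      by (metis norm_minus_commute norm_triangle_sub)
    ultimately have "B / 2 * norm (u - v) \<le> norm (\<phi> u - \<phi> v)"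
      using B(2)[of "u - v"] by linarith
    then show ?thesis using B(1) by (simp add: field_simps)
  qed
  show ?thesis
  proof (rule that[OF \<delta>(1) _ CU im\<Gamma>, of "max L' (2 / B)"])
    show "max L' (2 / B) > 0" using L' by auto
    fix u v assume uv: "u \<in> cball u0 \<delta>" "v \<in> cball u0 \<delta>"
    have "2 / B * norm (\<phi> u - \<phi> v) \<le> max L' (2 / B) * norm (\<phi> u - \<phi> v)" by (intro mult_right_mono) auto
    with low[OF uv] show "norm (u - v) \<le> max L' (2 / B) * norm (\<phi> u - \<phi> v)" by linarith
    have "L' * norm (u - v) \<le> max L' (2 / B) * norm (u - v)" by (intro mult_right_mono) auto
    with L'(2)[OF uv] show "norm (\<phi> u - \<phi> v) \<le> max L' (2 / B) * norm (u - v)" by linarith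
  qed
qed

text \<open>The chart sends the parameter ball of radius \<open>\<rho> / L\<close> into the ball of
  radius \<open>\<rho>\<close>, and the Lipschitz inverse transfers the Lebesgue measure of the
  former.\<close>

lemma hausdorff_outer_lower_density:
  fixes \<phi> :: "'k::euclidean_space \<Rightarrow> 'a::euclidean_space"
  assumes lp: "local_param \<phi> U V M" and u0: "u0 \<in> U"
    and \<Gamma>: "openin (top_of_set M) \<Gamma>" "\<phi> u0 \<in> \<Gamma>"
  obtains c \<rho>0 where "c > 0" "\<rho>0 > 0"
    "\<And>\<rho>. 0 < \<rho> \<Longrightarrow> \<rho> \<le> \<rho>0 \<Longrightarrow> ennreal (c * \<rho> ^ DIM('k)) \<le> hausdorff_outer (real DIM('k)) (ball (\<phi> u0) \<rho> \<inter> \<Gamma>)"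
proof -
  obtain \<delta> L where \<delta>: "\<delta> > 0" "L > 0" "cball u0 \<delta> \<subseteq> U" "\<phi> ` cball u0 \<delta> \<subseteq> \<Gamma>"
    and low: "\<And>u v. u \<in> cball u0 \<delta> \<Longrightarrow> v \<in> cball u0 \<delta> \<Longrightarrow> norm (u - v) \<le> L * norm (\<phi> u - \<phi> v)"
    and up: "\<And>u v. u \<in> cball u0 \<delta> \<Longrightarrow> v \<in> cball u0 \<delta> \<Longrightarrow> norm (\<phi> u - \<phi> v) \<le> L * norm (u - v)"
    by (rule local_param_bilipschitz[OF lp u0 \<Gamma>]) (rule that)
  let ?k = "DIM('k)"
  define c where "c = 1 / (2 * L) ^ ?k * (unit_ball_vol ?k * (1 / L) ^ ?k)"
  have c: "c > 0" using \<delta> by (simp add: c_def)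
  show ?thesis
  proof (rule that[OF c, of "\<delta> * L"])
    show "\<delta> * L > 0" using \<delta> by simp
    fix \<rho> assume \<rho>: "0 < \<rho>" "\<rho> \<le> \<delta> * L"
    have le: "\<rho> / L \<le> \<delta>" using \<rho> \<delta> by (simp add: field_simps)
    then have sub: "ball u0 (\<rho> / L) \<subseteq> cball u0 \<delta>" by auto
    have "c * \<rho> ^ ?k = 1 / (2 * L) ^ ?k * (unit_ball_vol ?k * (\<rho> / L) ^ ?k)"
      by (simp add: c_def power_divide)
    then have "ennreal (c * \<rho> ^ ?k) = ennreal (1 / (2 * L) ^ ?k) * ennreal (unit_ball_vol ?k * (\<rho> / L) ^ ?k)"
      using \<delta> \<rho> by (simp add: ennreal_mult[symmetric])
    also have "\<dots> = ennreal (1 / (2 * L) ^ ?k) * emeasure lborel (ball u0 (\<rho> / L))"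
      using \<delta> \<rho> by (simp add: emeasure_ball)
    also have "\<dots> \<le> hausdorff_outer (real ?k) (\<phi> ` ball u0 (\<rho> / L))"
      by (rule lborel_le_hausdorff_outer_image[OF \<delta>(2)]) (use low sub in blast)
    also have "\<dots> \<le> hausdorff_outer (real ?k) (ball (\<phi> u0) \<rho> \<inter> \<Gamma>)"
    proof (rule hausdorff_outer_mono, rule image_subsetI)
      fix u assume u: "u \<in> ball u0 (\<rho> / L)"
      then have "norm (\<phi> u0 - \<phi> u) \<le> L * norm (u0 - u)" using up sub \<delta> by auto
      also have "\<dots> < \<rho>" using u \<delta> by (simp add: dist_norm field_simps)
      finally have "\<phi> u \<in> ball (\<phi> u0) \<rho>" by (simp add: dist_norm)
      then show "\<phi> u \<in> ball (\<phi> u0) \<rho> \<inter> \<Gamma>" using u sub \<delta>(4) by blast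
    qed
    finally show "ennreal (c * \<rho> ^ ?k) \<le> hausdorff_outer (real ?k) (ball (\<phi> u0) \<rho> \<inter> \<Gamma>)" .
  qed
qed

text \<open>The part of the Radon-Nikodym derivative exceeding \<open>K\<close> integrates to 0, so
  the bound holds almost everywhere; truncation then makes it hold everywhere and the density
  real-valued.\<close>

lemma (in finite_measure) bounded_density_exists:
  assumes N: "sets N = sets M" and K: "K \<ge> 0" "\<And>A. A \<in> sets M \<Longrightarrow> emeasure N A \<le> ennreal K * emeasure M A"
  obtains h :: "'a \<Rightarrow> real" where "h \<in> borel_measurable M" "\<And>x. 0 \<le> h x" "\<And>x. h x \<le> K"
    "density M (\<lambda>x. ennreal (h x)) = N"
proof -
  have ac: "absolutely_continuous M N"
    unfolding absolutely_continuous_def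
  proof
    fix A assume A: "A \<in> null_sets M"
    then have "emeasure N A \<le> ennreal K * 0" using K(2)[of A] by (metis null_setsD1 null_setsD2)
    then show "A \<in> null_sets N" using A N by (auto intro!: null_setsI)
  qed
  define r where "r = RN_deriv M N"
  have mr[measurable]: "r \<in> borel_measurable M" by (simp add: r_def)
  have dr: "density M r = N" unfolding r_def by (rule density_RN_deriv[OF ac N])
  \<comment> \<open>The excess over \<open>K\<close> is compared after adding K times the measure of
    \<open>E\<close> back, which avoids truncated subtraction of integrals. That term is finite and
    can be cancelled.\<close>
  define E where "E = {x \<in> space M. r x > ennreal K}"
  have E[measurable]: "E \<in> sets M" unfolding E_def by measurable
  have "(\<integral>\<^sup>+x. (r x - ennreal K) * indicator E x \<partial>M) + ennreal K * emeasure M E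
      = (\<integral>\<^sup>+x. (r x - ennreal K) * indicator E x + ennreal K * indicator E x \<partial>M)"
    by (subst nn_integral_add) (auto simp: nn_integral_cmult_indicator)
  also have "\<dots> = (\<integral>\<^sup>+x. r x * indicator E x \<partial>M)"
    by (intro nn_integral_cong) (auto simp: E_def indicator_def diff_add_cancel_ennreal)
  also have "\<dots> = emeasure N E"
    unfolding dr[symmetric] by (rule emeasure_density[symmetric]) auto
  also have "\<dots> \<le> ennreal K * emeasure M E" using K(2) E by blast
  finally have "(\<integral>\<^sup>+x. (r x - ennreal K) * indicator E x \<partial>M) + ennreal K * emeasure M E \<le> 0 + ennreal K * emeasure M E"
    by simp
  moreover have "ennreal K * emeasure M E \<noteq> top"
    using emeasure_finite by (simp add: ennreal_mult_eq_top_iff)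
  ultimately have "(\<integral>\<^sup>+x. (r x - ennreal K) * indicator E x \<partial>M) = 0"
    by (simp add: ennreal_add_left_cancel_le add.commute)
  then have "AE x in M. (r x - ennreal K) * indicator E x = 0"
    by (subst (asm) nn_integral_0_iff_AE) auto
  then have AE: "AE x in M. r x \<le> ennreal K"
    by (rule AE_mp) (auto intro!: AE_I2 simp: E_def indicator_def diff_eq_0_iff_ennreal split: if_splits)
  define h where "h x = enn2real (min (r x) (ennreal K))" for x
  have fin: "min (r x) (ennreal K) < top" for x by (simp add: min_less_iff_disj)
  show ?thesis
  proof (rule that[of h])
    show "h \<in> borel_measurable M" unfolding h_def by measurable
    show "0 \<le> h x" "h x \<le> K" for x
      unfolding h_def using K(1) enn2real_mono[of "min (r x) (ennreal K)" "ennreal K"] by auto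
    have eh: "ennreal (h x) = min (r x) (ennreal K)" for x
      unfolding h_def by (rule ennreal_enn2real[OF fin])
    have "AE x in M. ennreal (h x) = r x"
      using AE by eventually_elim (simp add: eh min_def)
    then have "density M (\<lambda>x. ennreal (h x)) = density M r"
      unfolding eh by (intro density_cong) auto
    then show "density M (\<lambda>x. ennreal (h x)) = N" using dr by simp
  qed
qed

subsection \<open>Frames and decaying densities\<close>

lemma expo_mult_cnj: "expo x y * cnj (expo l y) = exp (\<i> * of_real (2 * pi * ((x - l) \<bullet> y)))"
  by (simp add: expo_def exp_cnj exp_add[symmetric] inner_diff_left algebra_simps)

lemma borel_measurable_expo [measurable]: "expo l \<in> borel_measurable borel"
  unfolding expo_def by (intro borel_measurable_continuous_onI continuous_intros)

lemma norm_exp_ii_minus_1_le: "norm (exp (\<i> * of_real t) - 1) \<le> \<bar>t\<bar>"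
  using abs_sin_x_le_abs_x[of "t / 2"] by (simp add: dist_exp_i_1)

locale frame_bounds = finite_measure \<mu> for \<mu> :: "'a::euclidean_space measure" +
  fixes \<Lambda> :: "'a set" and A B :: real
  assumes sets_\<mu> [measurable_cong]: "sets \<mu> = sets borel"
    and A: "A > 0" and B: "B > 0"
    and frame: "\<And>f. f \<in> borel_measurable \<mu> \<Longrightarrow> integrable \<mu> (\<lambda>x. (cmod (f x))\<^sup>2) \<Longrightarrow>
      (\<lambda>l. (cmod (\<integral>x. f x * cnj (expo l x) \<partial>\<mu>))\<^sup>2) summable_on \<Lambda> \<and>
      A * (\<integral>x. (cmod (f x))\<^sup>2 \<partial>\<mu>) \<le> infsum (\<lambda>l. (cmod (\<integral>x. f x * cnj (expo l x) \<partial>\<mu>))\<^sup>2) \<Lambda> \<and>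
      infsum (\<lambda>l. (cmod (\<integral>x. f x * cnj (expo l x) \<partial>\<mu>))\<^sup>2) \<Lambda> \<le> B * (\<integral>x. (cmod (f x))\<^sup>2 \<partial>\<mu>)"
begin

text \<open>The radius 1/(4 pi r) is chosen so that the phase difference between \<open>x\<close>
  and a frequency within r of it varies by at most 1/2 from the centre of the ball. Each such
  coefficient of the test character then has modulus at least half the mass m of the ball, and the
  squares, at least m^2/4 each, compete with the upper bound B m.\<close>

lemma card_frequencies_le:
  assumes r: "r > 0" and F: "finite F" "F \<subseteq> \<Lambda>" "F \<subseteq> cball x r"
    and M: "measure \<mu> (ball p (1 / (4 * pi * r))) > 0"
  shows "card F * measure \<mu> (ball p (1 / (4 * pi * r))) \<le> 4 * B"
proof -
  define S where "S = ball p (1 / (4 * pi * r))"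
  define m where "m = measure \<mu> S"
  have m: "m > 0" using M by (simp add: m_def S_def)
  have S[measurable]: "S \<in> sets \<mu>" by (simp add: sets_\<mu> S_def)
  define f where "f = (\<lambda>y. expo x y * indicator S y)"
  have f[measurable]: "f \<in> borel_measurable \<mu>"
    unfolding f_def by measurable
  have f2: "(cmod (f y))\<^sup>2 = indicator S y" for y
    by (auto simp: f_def expo_def indicator_def norm_mult)
  have intS: "integrable \<mu> (indicator S :: 'a \<Rightarrow> real)"
    by (intro integrable_real_indicator S) (simp add: less_top[symmetric])
  let ?c = "\<lambda>l. (cmod (\<integral>y. f y * cnj (expo l y) \<partial>\<mu>))\<^sup>2"
  have fr: "?c summable_on \<Lambda>" "infsum ?c \<Lambda> \<le> B * m"
    using frame[OF f] intS S by (auto simp: f2 m_def)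
  have low: "?c l \<ge> (m / 2)\<^sup>2" if l: "l \<in> F" for l
  proof -
    define e where "e y = exp (\<i> * of_real (2 * pi * ((x - l) \<bullet> (y - p))))" for y
    \<comment> \<open>The phase at the centre is constant and drops out of the modulus, leaving a
      factor close to 1 on the ball.\<close>
    define z where "z = exp (\<i> * of_real (2 * pi * ((x - l) \<bullet> p)))"
    have me[measurable]: "e \<in> borel_measurable borel"
      unfolding e_def by (intro borel_measurable_continuous_onI continuous_intros)
    have "f y * cnj (expo l y) = z * (e y * indicator S y)" for y
    proof -
      have "f y * cnj (expo l y) = exp (\<i> * of_real (2 * pi * ((x - l) \<bullet> y))) * indicator S y"
        using expo_mult_cnj[of x y l] by (simp add: f_def mult_ac)
      also have "exp (\<i> * of_real (2 * pi * ((x - l) \<bullet> y))) = z * e y"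
        by (simp add: z_def e_def exp_add[symmetric] inner_diff_right algebra_simps)
      finally show ?thesis by (simp add: mult_ac)
    qed
    then have eq: "cmod (\<integral>y. f y * cnj (expo l y) \<partial>\<mu>) = cmod (\<integral>y. e y * indicator S y \<partial>\<mu>)"
      by (simp add: norm_mult z_def)
    have int1: "integrable \<mu> (\<lambda>y. e y * indicator S y)"
      by (rule Bochner_Integration.integrable_bound[OF intS]) (auto simp: norm_mult e_def indicator_def)
    have int2: "integrable \<mu> (\<lambda>y. complex_of_real (indicator S y))"
      using intS by (rule integrable_of_real)
    have "cmod ((\<integral>y. e y * indicator S y \<partial>\<mu>) - of_real m) \<le> m / 2"
    proof -
      have "(\<integral>y. e y * indicator S y \<partial>\<mu>) - of_real m = (\<integral>y. e y * indicator S y - of_real (indicator S y) \<partial>\<mu>)"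
        using int1 int2 S by (simp add: m_def)
      also have "cmod \<dots> \<le> (\<integral>y. cmod (e y * indicator S y - of_real (indicator S y)) \<partial>\<mu>)"
        by (rule integral_norm_bound)
      also have "\<dots> \<le> (\<integral>y. 1 / 2 * indicator S y \<partial>\<mu>)"
      proof (rule integral_mono')
        show "integrable \<mu> (\<lambda>y. 1 / 2 * indicator S y :: real)" using intS by simp
        show "cmod (e y * indicator S y - of_real (indicator S y)) \<le> 1 / 2 * indicator S y" for y
        proof (cases "y \<in> S")
          case True
          have 1: "norm (x - l) \<le> r" using F(3) l by (auto simp: dist_norm)
          have 2: "norm (y - p) \<le> 1 / (4 * pi * r)" using True by (simp add: S_def dist_norm norm_minus_commute)
          have "\<bar>(x - l) \<bullet> (y - p)\<bar> \<le> norm (x - l) * norm (y - p)" by (rule Cauchy_Schwarz_ineq2)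
          also have "\<dots> \<le> r * (1 / (4 * pi * r))" using 1 2 r by (intro mult_mono) auto
          also have "\<dots> = 1 / (4 * pi)" using r by simp
          finally have "\<bar>2 * pi * ((x - l) \<bullet> (y - p))\<bar> \<le> 1 / 2"
            using pi_gt_zero by (simp add: abs_mult field_simps)
          then have "cmod (e y - 1) \<le> 1 / 2"
            using norm_exp_ii_minus_1_le[of "2 * pi * ((x - l) \<bullet> (y - p))"] unfolding e_def by linarith
          then show ?thesis using True by simp
        qed simp
      qed simp
      also have "\<dots> = m / 2" using S by (simp add: m_def)
      finally show ?thesis .
    qed
    moreover have "cmod (of_real m) \<le> cmod (\<integral>y. e y * indicator S y \<partial>\<mu>) + cmod ((\<integral>y. e y * indicator S y \<partial>\<mu>) - of_real m)"
      by (metis norm_minus_commute norm_triangle_sub)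
    ultimately have "m / 2 \<le> cmod (\<integral>y. f y * cnj (expo l y) \<partial>\<mu>)"
      unfolding eq using m by simp
    then show ?thesis using m by (intro power_mono) auto
  qed
  have "card F * (m / 2)\<^sup>2 \<le> sum ?c F"
    using sum_bounded_below[of F "(m / 2)\<^sup>2" ?c] low by simp
  also have "\<dots> \<le> infsum ?c \<Lambda>"
    by (rule finite_sum_le_infsum[OF fr(1) F(1,2)]) simp
  also have "\<dots> \<le> B * m" by (rule fr(2))
  finally have "(card F * m) * m \<le> (4 * B) * m" by (simp add: power2_eq_square)
  then have "card F * m \<le> 4 * B" using m by (simp only: mult_le_cancel_right_pos)
  then show ?thesis by (simp add: m_def S_def)
qed

lemma card_frequencies_le_power:
  assumes c: "c > 0" "\<rho>0 > 0" "\<And>\<rho>. 0 < \<rho> \<Longrightarrow> \<rho> \<le> \<rho>0 \<Longrightarrow> c * \<rho> ^ k \<le> measure \<mu> (ball p \<rho>)"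
  obtains C r0 where "C > 0" "r0 \<ge> 1"
    "\<And>F x r. r \<ge> r0 \<Longrightarrow> finite F \<Longrightarrow> F \<subseteq> \<Lambda> \<Longrightarrow> F \<subseteq> cball x r \<Longrightarrow> real (card F) \<le> C * r ^ k"
proof (rule that)
  define C where "C = 4 * B * (4 * pi) ^ k / c"
  \<comment> \<open>The second entry guarantees a test radius of at most \<open>\<rho>0\<close>,
    where the density hypothesis applies.\<close>
  define r0 where "r0 = max 1 (1 / (4 * pi * \<rho>0))"
  show "C > 0" using B c by (simp add: C_def)
  show "r0 \<ge> 1" by (simp add: r0_def)
  fix F :: "'a set" and x :: 'a and r :: real
  assume r: "r \<ge> r0" and F: "finite F" "F \<subseteq> \<Lambda>" "F \<subseteq> cball x r"
  have rp: "r > 0" using r by (simp add: r0_def)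
  let ?\<rho> = "1 / (4 * pi * r)"
  have "1 / (4 * pi * \<rho>0) \<le> r" using r by (simp add: r0_def)
  then have \<rho>: "0 < ?\<rho>" "?\<rho> \<le> \<rho>0" using rp c by (auto simp: field_simps)
  have m: "c * ?\<rho> ^ k \<le> measure \<mu> (ball p ?\<rho>)" by (rule c(3)[OF \<rho>])
  have p: "c * ?\<rho> ^ k > 0" using c \<rho> by simp
  have "card F * (c * ?\<rho> ^ k) \<le> card F * measure \<mu> (ball p ?\<rho>)" using m by (intro mult_left_mono) auto
  also have "\<dots> \<le> 4 * B" by (rule card_frequencies_le[OF rp F]) (use m p in linarith)
  finally have "card F \<le> 4 * B / (c * ?\<rho> ^ k)" using p by (simp only: pos_le_divide_eq)
  also have "\<dots> = C * r ^ k" by (simp add: C_def power_divide power_mult_distrib)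
  finally show "real (card F) \<le> C * r ^ k" .
qed

end

text \<open>A volume count: if every point were within T of a frequency, the ball of radius
  \<open>\<rho>\<close> would be covered by T-balls about the frequencies in the ball of radius
  \<open>\<rho> + T\<close>. Their number grows only like the k-th power of \<open>\<rho>\<close>,
  and k is smaller than the dimension.\<close>

lemma exists_far_point:
  fixes \<Lambda> :: "'a::euclidean_space set"
  assumes C: "C > 0" "r0 \<ge> 1"
    "\<And>F x r. r \<ge> r0 \<Longrightarrow> finite F \<Longrightarrow> F \<subseteq> \<Lambda> \<Longrightarrow> F \<subseteq> cball x r \<Longrightarrow> real (card F) \<le> C * r ^ k"
    and k: "k < DIM('a)" and T: "T > 0"
  shows "\<exists>\<xi>. \<forall>l\<in>\<Lambda>. norm (l - \<xi>) \<ge> T"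
proof (rule ccontr)
  assume "\<not> ?thesis"
  then have near: "\<exists>l\<in>\<Lambda>. norm (l - \<xi>) < T" for \<xi> by (meson not_le)
  \<comment> \<open>Exceeding C 2^k T^d makes the final comparison with the power k + 1, at most d,
    strict; \<open>\<rho> \<ge> T\<close> allows \<open>\<rho> + T\<close> to be replaced by
    \<open>2 * \<rho>\<close>.\<close>
  define \<rho> where "\<rho> = max r0 T + C * 2 ^ k * T ^ DIM('a)"
  have \<rho>: "\<rho> \<ge> r0" "\<rho> \<ge> T" "\<rho> \<ge> 1" "\<rho> > C * 2 ^ k * T ^ DIM('a)"
  proof -
    have "C * 2 ^ k * T ^ DIM('a) > 0" using C T by simp
    then show "\<rho> \<ge> r0" "\<rho> \<ge> T" "\<rho> \<ge> 1" "\<rho> > C * 2 ^ k * T ^ DIM('a)"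
      using C T unfolding \<rho>_def by linarith+
  qed
  define F where "F = \<Lambda> \<inter> cball 0 (\<rho> + T)"
  \<comment> \<open>The counting hypothesis speaks of finite sets only; an infinite set would
    contain finite subsets violating it.\<close>
  have fin: "finite F"
  proof (rule ccontr)
    assume "infinite F"
    obtain G where G: "finite G" "card G = Suc (nat \<lceil>C * (\<rho> + T) ^ k\<rceil>)" "G \<subseteq> F"
      using infinite_arbitrarily_large[OF \<open>infinite F\<close>] by metis
    have "real (card G) \<le> C * (\<rho> + T) ^ k"
      by (rule C(3)[of _ _ 0]) (use G \<rho> T in \<open>auto simp: F_def\<close>)
    with G(2) show False by linarith
  qed
  have cardF: "real (card F) \<le> C * (\<rho> + T) ^ k"
    by (rule C(3)[of _ _ 0]) (use fin \<rho> T in \<open>auto simp: F_def\<close>)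
  have sub: "ball 0 \<rho> \<subseteq> (\<Union>l\<in>F. ball l T)"
  proof
    fix \<xi> :: 'a assume \<xi>: "\<xi> \<in> ball 0 \<rho>"
    obtain l where l: "l \<in> \<Lambda>" "norm (l - \<xi>) < T" using near by blast
    have "norm l \<le> norm \<xi> + norm (l - \<xi>)" by (rule norm_triangle_sub)
    then have "l \<in> F" using l \<xi> by (simp add: F_def)
    with l show "\<xi> \<in> (\<Union>l\<in>F. ball l T)" by (auto simp: dist_norm)
  qed
  let ?v = "unit_ball_vol (real DIM('a))"
  have v: "?v > 0" by simp
  have "?v * \<rho> ^ DIM('a) = measure lborel (ball (0::'a) \<rho>)" using \<rho> by (simp add: content_ball)
  also have "\<dots> \<le> measure lborel (\<Union>l\<in>F. ball l T)"
  proof (rule measure_mono_fmeasurable[OF sub])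
    have "bounded (\<Union>l\<in>F. ball l T)" "open (\<Union>l\<in>F. ball l T)" using fin by auto
    then show "(\<Union>l\<in>F. ball l T) \<in> fmeasurable lborel"
      using emeasure_bounded_finite[of "\<Union>l\<in>F. ball l T"] borel_open[of "\<Union>l\<in>F. ball l T"]
      by (intro fmeasurableI) (simp_all only: sets_lborel)
  qed simp
  also have "\<dots> \<le> (\<Sum>l\<in>F. measure lborel (ball l T))"
    by (rule measure_UNION_le[OF fin]) simp
  also have "\<dots> = card F * (?v * T ^ DIM('a))" using T by (simp add: content_ball)
  finally have "\<rho> ^ DIM('a) \<le> card F * T ^ DIM('a)" using v by (simp add: algebra_simps)
  also have "\<dots> \<le> (C * (2 * \<rho>) ^ k) * T ^ DIM('a)"
  proof (rule mult_right_mono)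
    have "(\<rho> + T) ^ k \<le> (2 * \<rho>) ^ k" using \<rho> T by (intro power_mono) auto
    then show "real (card F) \<le> C * (2 * \<rho>) ^ k" using cardF C(1)
      by (meson mult_le_cancel_left_pos order_trans)
  qed (use T in auto)
  also have "\<dots> = \<rho> ^ k * (C * 2 ^ k * T ^ DIM('a))" by (simp add: power_mult_distrib algebra_simps)
  also have "\<dots> < \<rho> ^ k * \<rho>" using \<rho> by (intro mult_strict_left_mono) auto
  also have "\<dots> = \<rho> ^ Suc k" by simp
  also have "\<dots> \<le> \<rho> ^ DIM('a)" using \<rho> k by (intro power_increasing) auto
  finally show False by simp
qed

section \<open>Summation over dyadic shells\<close>

lemma dyadic_scale:
  fixes x T :: real
  assumes "T > 0" "x \<ge> T"
  shows "\<exists>j. 2 ^ j * T \<le> x \<and> x \<le> 2 ^ Suc j * T"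
proof -
  obtain n where "x / T < 2 ^ n" using real_arch_pow[of 2 "x / T"] by auto
  define m where "m = (LEAST n. x / T < 2 ^ n)"
  have m: "x / T < 2 ^ m" unfolding m_def by (rule LeastI) fact
  have "m \<noteq> 0"
  proof
    assume "m = 0"
    with m assms show False by (simp add: divide_less_eq)
  qed
  then obtain j where j: "m = Suc j" by (cases m) auto
  have "\<not> x / T < 2 ^ j" using not_less_Least[of j "\<lambda>n. x / T < 2 ^ n"] j by (simp add: m_def)
  with m j assms(1) show ?thesis by (intro exI[of _ j]) (auto simp: field_simps)
qed

text \<open>Shell j holds at most C (2^(j+1) T)^k frequencies, each contributing at most D (2^j
  T)^(-s), so the bounds on consecutive shells have ratio 2^(k-s) < 1.\<close>

lemma sum_decay_le:
  fixes \<Lambda> :: "'a::euclidean_space set" and q :: "'a \<Rightarrow> real"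
  assumes C: "C > 0"
    "\<And>F x r. r \<ge> r0 \<Longrightarrow> finite F \<Longrightarrow> F \<subseteq> \<Lambda> \<Longrightarrow> F \<subseteq> cball x r \<Longrightarrow> real (card F) \<le> C * r ^ k"
    and T: "T > 0" "T \<ge> r0" and far: "\<And>l. l \<in> \<Lambda> \<Longrightarrow> norm (l - \<xi>) \<ge> T"
    and D: "D > 0" and s: "s > real k" and q: "\<And>l. l \<in> \<Lambda> \<Longrightarrow> q l \<le> D * norm (l - \<xi>) powr (- s)"
    and F: "finite F" "F \<subseteq> \<Lambda>"
  shows "sum q F \<le> C * D * 2 ^ k * T powr (real k - s) / (1 - 2 powr (real k - s))"
proof -
  \<comment> \<open>Neighbouring shells share a boundary sphere; choosing one index per frequency
    makes the groups disjoint.\<close>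
  define J where "J l = (SOME j. 2 ^ j * T \<le> norm (l - \<xi>) \<and> norm (l - \<xi>) \<le> 2 ^ Suc j * T)" for l
  have J: "2 ^ J l * T \<le> norm (l - \<xi>)" "norm (l - \<xi>) \<le> 2 ^ Suc (J l) * T" if "l \<in> \<Lambda>" for l
    using someI_ex[OF dyadic_scale[OF T(1) far[OF that]]] unfolding J_def by auto
  define x where "x = 2 powr (real k - s)"
  have x: "0 < x" "x < 1" using s powr_less_cancel_iff[of 2 "real k - s" 0] by (auto simp: x_def)
  let ?G = "\<lambda>j. {l \<in> F. J l = j}"
  define E where "E = C * D * 2 ^ k * T powr (real k - s)"
  have E: "E > 0" using C D T by (simp add: E_def)
  have group: "sum q (?G j) \<le> E * x ^ j" for j
  proof -
    have "sum q (?G j) \<le> (\<Sum>l\<in>?G j. D * (2 ^ j * T) powr (- s))"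
    proof (rule sum_mono)
      fix l assume "l \<in> ?G j"
      then have l: "l \<in> \<Lambda>" "J l = j" using F by auto
      have "norm (l - \<xi>) powr (- s) \<le> (2 ^ j * T) powr (- s)"
        using J(1)[OF l(1)] l T s by (intro powr_mono2') auto
      then show "q l \<le> D * (2 ^ j * T) powr (- s)"
        using q[OF l(1)] D by (meson mult_le_cancel_left_pos order_trans)
    qed
    also have "\<dots> = card (?G j) * (D * (2 ^ j * T) powr (- s))" by simp
    also have "\<dots> \<le> (C * (2 ^ Suc j * T) ^ k) * (D * (2 ^ j * T) powr (- s))"
    proof (rule mult_right_mono)
      have "2 ^ Suc j * T \<ge> 1 * T" using T(1) by (intro mult_right_mono) (auto simp: one_le_power simp del: power_Suc)
      then have "2 ^ Suc j * T \<ge> r0" using T by linarith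
      then show "real (card (?G j)) \<le> C * (2 ^ Suc j * T) ^ k"
        by (rule C(2)[of _ _ \<xi>]) (use F J in \<open>auto simp: dist_norm norm_minus_commute\<close>)
    qed (use D in auto)
    also have "\<dots> = C * D * 2 ^ k * ((2 ^ j * T) ^ k * (2 ^ j * T) powr (- s))"
      by (simp add: power_mult_distrib algebra_simps)
    also have "(2 ^ j * T) ^ k * (2 ^ j * T) powr (- s) = (2 ^ j * T) powr (real k - s)"
      using T(1) by (simp add: powr_realpow[symmetric] powr_add[symmetric])
    also have "\<dots> = x ^ j * T powr (real k - s)"
      using T(1) by (simp add: powr_mult x_def powr_realpow[symmetric] powr_powr mult.commute)
    finally show ?thesis by (simp add: E_def algebra_simps)
  qed
  obtain n where n: "J ` F \<subseteq> {..<n}" using F(1) finite_nat_iff_bounded by (metis finite_imageI)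
  have "sum q F = (\<Sum>j<n. sum q (?G j))" using sum.group[OF F(1) finite_lessThan n, of q] by simp
  also have "\<dots> \<le> (\<Sum>j<n. E * x ^ j)" by (intro sum_mono group)
  also have "\<dots> = E * (\<Sum>j<n. x ^ j)" by (simp add: sum_distrib_left)
  also have "\<dots> \<le> E * (1 / (1 - x))"
  proof (rule mult_left_mono)
    have "summable ((^) x)" "suminf ((^) x) = 1 / (1 - x)" using x summable_geometric[of x] suminf_geometric[of x] by auto
    then show "(\<Sum>j<n. x ^ j) \<le> 1 / (1 - x)" using sum_le_suminf[of "(^) x" "{..<n}"] x by simp
  qed (use E in simp)
  finally show ?thesis by (simp add: E_def x_def)
qed

text \<open>Only the lower frame inequality is contradicted: it bounds a fixed positive number by a
  constant times T^(k-s) for every T from \<open>r0\<close> on, which fails in the limit. The upper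
  inequality has been spent on counting frequencies.\<close>

lemma no_fourier_frame_if_decaying_density:
  fixes \<mu> :: "'a::euclidean_space measure" and h :: "'a \<Rightarrow> real"
  assumes \<mu>: "finite_measure \<mu>" "sets \<mu> = sets borel"
    and h: "h \<in> borel_measurable \<mu>" "\<And>x. \<bar>h x\<bar> \<le> K" "(\<integral>x. h x \<partial>\<mu>) \<noteq> 0"
    and s: "s > real k" and D: "D > 0"
    and decay: "\<And>\<eta>. norm \<eta> \<ge> 1 \<Longrightarrow> (cmod (\<integral>x. of_real (h x) * exp (- (\<i> * of_real (2 * pi * (\<eta> \<bullet> x)))) \<partial>\<mu>))\<^sup>2 \<le> D * norm \<eta> powr (- s)"
    and k: "k < DIM('a)"
    and c: "c > 0" "\<epsilon> > 0" "\<And>\<rho>. 0 < \<rho> \<Longrightarrow> \<rho> \<le> \<epsilon> \<Longrightarrow> c * \<rho> ^ k \<le> measure \<mu> (ball p \<rho>)"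
  shows "\<not> admits_fourier_frame \<mu>"
proof
  assume "admits_fourier_frame \<mu>"
  then obtain \<Lambda> A B where "0 < A" "0 < B" and fr: "\<forall>f::'a \<Rightarrow> complex. f \<in> borel_measurable \<mu> \<and> integrable \<mu> (\<lambda>x. (cmod (f x))\<^sup>2) \<longrightarrow>
          (let nf = (\<integral>x. (cmod (f x))\<^sup>2 \<partial>\<mu>);
               c = (\<lambda>l. (cmod (\<integral>x. f x * cnj (expo l x) \<partial>\<mu>))\<^sup>2)
           in c summable_on \<Lambda> \<and> A * nf \<le> infsum c \<Lambda> \<and> infsum c \<Lambda> \<le> B * nf)"
    unfolding admits_fourier_frame_def fourier_frame_def by blast
  interpret frame_bounds \<mu> \<Lambda> A B
  proof (intro frame_bounds.intro frame_bounds_axioms.intro \<mu> \<open>0 < A\<close> \<open>0 < B\<close>)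
    fix f :: "'a \<Rightarrow> complex"
    assume f: "f \<in> borel_measurable \<mu>" "integrable \<mu> (\<lambda>x. (cmod (f x))\<^sup>2)"
    show "(\<lambda>l. (cmod (\<integral>x. f x * cnj (expo l x) \<partial>\<mu>))\<^sup>2) summable_on \<Lambda> \<and>
      A * (\<integral>x. (cmod (f x))\<^sup>2 \<partial>\<mu>) \<le> infsum (\<lambda>l. (cmod (\<integral>x. f x * cnj (expo l x) \<partial>\<mu>))\<^sup>2) \<Lambda> \<and>
      infsum (\<lambda>l. (cmod (\<integral>x. f x * cnj (expo l x) \<partial>\<mu>))\<^sup>2) \<Lambda> \<le> B * (\<integral>x. (cmod (f x))\<^sup>2 \<partial>\<mu>)"
      using fr[rule_format, OF conjI[OF f]] unfolding Let_def .
  qed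
  note [measurable] = h(1)
  obtain C r0 where C: "C > 0" "r0 \<ge> 1"
    "\<And>F x r. r \<ge> r0 \<Longrightarrow> finite F \<Longrightarrow> F \<subseteq> \<Lambda> \<Longrightarrow> F \<subseteq> cball x r \<Longrightarrow> real (card F) \<le> C * r ^ k"
    by (rule card_frequencies_le_power[OF c]) (assumption+, rule that)
  have K: "K \<ge> 0" using h(2)[of undefined] by linarith
  have inth: "integrable \<mu> h"
    by (rule integrable_const_bound[of _ K]) (use h in auto)
  have inth2: "integrable \<mu> (\<lambda>x. (h x)\<^sup>2)"
  proof (rule integrable_const_bound[of _ "K\<^sup>2"])
    show "AE x in \<mu>. norm ((h x)\<^sup>2) \<le> K\<^sup>2"
      using h(2) by (auto intro!: AE_I2 simp: abs_le_square_iff[symmetric] abs_of_nonneg[OF K])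
  qed measurable
  define q where "q = (\<integral>x. (h x)\<^sup>2 \<partial>\<mu>)"
  \<comment> \<open>The non-zero integral of \<open>h\<close> prevents it from vanishing almost
    everywhere.\<close>
  have "q \<noteq> 0"
  proof
    assume "q = 0"
    then have "AE x in \<mu>. (h x)\<^sup>2 = 0"
      using integral_nonneg_eq_0_iff_AE[OF inth2] by (simp add: q_def)
    then have "AE x in \<mu>. h x = 0" by simp
    then have "(\<integral>x. h x \<partial>\<mu>) = (\<integral>x. 0 \<partial>\<mu>)" by (intro integral_cong_AE) auto
    with h(3) show False by simp
  qed
  moreover have "q \<ge> 0" by (simp add: q_def)
  ultimately have q: "q > 0" by simp
  have bound: "A * q \<le> C * D * 2 ^ k / (1 - 2 powr (real k - s)) * T powr (real k - s)" if T: "T \<ge> r0" for T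
  proof -
    have T0: "T > 0" "T \<ge> 1" using T C by auto
    have "\<exists>\<xi>. \<forall>l\<in>\<Lambda>. norm (l - \<xi>) \<ge> T"
      by (rule exists_far_point[where \<Lambda>=\<Lambda>, OF C(1,2) _ k T0(1)]) (rule C(3))
    then obtain \<xi> where "\<forall>l\<in>\<Lambda>. norm (l - \<xi>) \<ge> T" by (rule exE) (rule that)
    then have \<xi>: "\<And>l. l \<in> \<Lambda> \<Longrightarrow> norm (l - \<xi>) \<ge> T" by blast
    define f where "f x = of_real (h x) * expo \<xi> x" for x
    have f: "f \<in> borel_measurable \<mu>" unfolding f_def by measurable
    have f2: "(cmod (f x))\<^sup>2 = (h x)\<^sup>2" for x
      by (simp add: f_def norm_mult expo_def power_mult_distrib)
    let ?c = "\<lambda>l. (cmod (\<integral>x. f x * cnj (expo l x) \<partial>\<mu>))\<^sup>2"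
    \<comment> \<open>Modulation translates the transform: the coefficient at \<open>l\<close> is
      the transform of the density at \<open>l - \<xi>\<close>, a vector of norm at least T when
      \<open>l\<close> is a frequency.\<close>
    have fc: "f x * cnj (expo l x) = of_real (h x) * exp (- (\<i> * of_real (2 * pi * ((l - \<xi>) \<bullet> x))))" for l x
      using expo_mult_cnj[of \<xi> x l] by (simp add: f_def mult.assoc inner_diff_left algebra_simps)
    have cb: "?c l \<le> D * norm (l - \<xi>) powr (- s)" if "l \<in> \<Lambda>" for l
      unfolding fc by (rule decay) (use \<xi>[OF that] T0 in linarith)
    have "?c summable_on \<Lambda>" "A * q \<le> infsum ?c \<Lambda>"
      using frame[OF f] inth2 by (auto simp: f2 q_def)
    moreover have "infsum ?c \<Lambda> \<le> C * D * 2 ^ k * T powr (real k - s) / (1 - 2 powr (real k - s))"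
    proof (rule infsum_le_finite_sums[OF calculation(1)])
      fix F assume "finite F" "F \<subseteq> \<Lambda>"
      then show "sum ?c F \<le> C * D * 2 ^ k * T powr (real k - s) / (1 - 2 powr (real k - s))"
        by (intro sum_decay_le[where \<Lambda>=\<Lambda> and \<xi>=\<xi>, OF C(1) _ T0(1) T _ D s])
          (rule C(3) \<xi> cb; assumption)+
    qed
    ultimately show ?thesis by simp
  qed
  let ?E = "C * D * 2 ^ k / (1 - 2 powr (real k - s))"
  have "((\<lambda>T. ?E * T powr (real k - s)) \<longlongrightarrow> ?E * 0) at_top"
    using s by (intro tendsto_mult tendsto_const tendsto_neg_powr filterlim_ident) auto
  moreover have "\<forall>\<^sub>F T in at_top. A * q \<le> ?E * T powr (real k - s)"
    using eventually_ge_at_top[of r0] by eventually_elim (rule bound)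
  ultimately have "A * q \<le> ?E * 0"
    by (intro tendsto_lowerbound) auto
  with A q show False by (simp add: mult_le_0_iff)
qed

subsection \<open>The mixed measure\<close>

text \<open>The orthogonal complement of the range of \<open>D\<close> has dimension one and
  contains \<open>N\<close>, so \<open>N\<close> spans it.\<close>

lemma orthogonal_to_hyperplane:
  fixes D :: "'m::euclidean_space \<Rightarrow> 'a::euclidean_space"
  assumes D: "linear D" "inj D" and dim: "DIM('m) = DIM('a) - 1" "DIM('a) \<ge> 1"
    and N: "N \<noteq> 0" "\<And>b. b \<in> Basis \<Longrightarrow> D b \<bullet> N = 0"
    and \<omega>: "\<And>b. b \<in> Basis \<Longrightarrow> D b \<bullet> \<omega> = 0"
  obtains t where "\<omega> = t *\<^sub>R N"
proof -
  let ?W = "{y \<in> UNIV. \<forall>x\<in>range D. orthogonal x y}"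
  have "dim (range D) = DIM('m)"
    using dim_image_eq[OF D(1), of UNIV] D(2) by (simp add: inj_on_def)
  moreover have "dim ?W + dim (range D) = dim (UNIV :: 'a set)"
    using D(1) by (intro dim_subspace_orthogonal_to_vectors) (auto intro: linear_subspace_image)
  ultimately have W: "dim ?W \<le> 1" using dim by simp
  have mem: "y \<in> ?W" if y: "\<And>b. b \<in> Basis \<Longrightarrow> D b \<bullet> y = 0" for y
  proof -
    have "D w \<bullet> y = 0" for w
    proof -
      have "D w = (\<Sum>b\<in>Basis. (w \<bullet> b) *\<^sub>R D b)"
        by (subst euclidean_representation[of w, symmetric]) (simp only: linear_sum[OF D(1)] linear_scale[OF D(1)])
      then show ?thesis using y by (simp add: inner_sum_left)
    qed
    then show ?thesis by (auto simp: orthogonal_def)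
  qed
  have "?W \<subseteq> span {N}"
    using mem[OF N(2)] N(1) W by (intro card_ge_dim_independent) (auto simp: independent_insert)
  then have "\<omega> \<in> span {N}" using mem[OF \<omega>] by blast
  then show ?thesis using that by (auto simp: span_singleton)
qed

text \<open>With the complex exponential for \<open>e\<close>, this identifies the Fourier transform
  of the density with an oscillatory integral in the chart; with the constant 1 it computes the
  total mass.\<close>

lemma integral_pushforward_density:
  fixes e :: "'a::euclidean_space \<Rightarrow> 'b::{banach, second_countable_topology}"
  assumes "sets \<mu> = sets borel" and T[measurable]: "T \<in> borel_measurable borel"
    and g[measurable]: "g \<in> borel_measurable borel" and g0: "\<And>v. 0 \<le> g v"
    and h: "h \<in> borel_measurable \<mu>" "\<And>x. 0 \<le> h x"
    and eq: "density \<mu> (\<lambda>x. ennreal (h x)) = distr (density lborel (\<lambda>v. ennreal (g v))) borel T"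
    and e[measurable]: "e \<in> borel_measurable borel"
  shows "(\<integral>x. h x *\<^sub>R e x \<partial>\<mu>) = (\<integral>v. g v *\<^sub>R e (T v) \<partial>lborel)"
proof -
  have em: "e \<in> borel_measurable \<mu>"
    using e assms(1) measurable_cong_sets by blast
  have "(\<integral>x. h x *\<^sub>R e x \<partial>\<mu>) = integral\<^sup>L (density \<mu> (\<lambda>x. ennreal (h x))) e"
    by (rule integral_density[symmetric]) (use em h in auto)
  also have "\<dots> = (\<integral>v. e (T v) \<partial>density lborel (\<lambda>v. ennreal (g v)))"
    unfolding eq by (rule integral_distr) auto
  also have "\<dots> = (\<integral>v. g v *\<^sub>R e (T v) \<partial>lborel)"
    by (rule integral_density) (use g0 in auto)
  finally show ?thesis .
qed

text \<open>A direction orthogonal to no tangent hyperplane but the given one is no loss: if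
  \<open>\<omega>\<close> is not normal, the first alternative holds. If it is, it is a multiple of
  \<open>N\<close>, and non-zero curvature says that the second fundamental form has no
  kernel.\<close>

lemma curvature_nondegenerate:
  fixes \<phi> :: "'m::euclidean_space \<Rightarrow> 'a::euclidean_space"
  assumes dim: "DIM('m) = DIM('a) - 1" and lp: "local_param \<phi> U V M" and u: "u \<in> U"
    and N: "norm N = 1" "\<And>i. i \<in> Basis \<Longrightarrow> frechet_derivative \<phi> (at u) i \<bullet> N = 0"
    and K: "gauss_curvature_chart \<phi> u N \<noteq> 0"
    and w: "norm \<omega> = 1" "norm w = 1"
  shows "(\<exists>a\<in>Basis. \<omega> \<bullet> frechet_derivative \<phi> (at u) a \<noteq> 0) \<or>
      (\<exists>a\<in>Basis. \<omega> \<bullet> frechet_derivative (\<lambda>x. frechet_derivative \<phi> (at x) a) (at u) w \<noteq> 0)"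
proof (rule disjCI)
  assume neg: "\<not> (\<exists>a\<in>Basis. \<omega> \<bullet> frechet_derivative (\<lambda>x. frechet_derivative \<phi> (at x) a) (at u) w \<noteq> 0)"
  let ?D = "frechet_derivative \<phi> (at u)"
  let ?H = "\<lambda>a. frechet_derivative (\<lambda>x. frechet_derivative \<phi> (at x) a) (at u)"
  have U: "open U" "smooth_on U \<phi>" and inj: "inj ?D"
    using lp u by (auto simp: local_param_def)
  have lin: "linear ?D" using smooth_on_has_derivative[OF U(2) u] has_derivative_linear by blast
  have linH: "linear (?H a)" for a
    using smooth_on_has_derivative[OF smooth_on_frechet_derivative[OF U] u] has_derivative_linear by blast
  show "\<exists>a\<in>Basis. \<omega> \<bullet> ?D a \<noteq> 0"
  proof (rule ccontr)
    assume "\<not> ?thesis"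
    then have o: "?D b \<bullet> \<omega> = 0" if "b \<in> Basis" for b using that by (auto simp: inner_commute)
    have "DIM('a) \<ge> 1" using DIM_positive[where 'a='a] by linarith
    then obtain t where t: "\<omega> = t *\<^sub>R N"
      by (rule orthogonal_to_hyperplane[OF lin inj dim _ _ N(2) o]) (use N(1) in auto)
    have t0: "t \<noteq> 0" using t w(1) by auto
    have "det_form (\<lambda>i j. ?H j i \<bullet> N) \<noteq> 0"
      using K by (auto simp: gauss_curvature_chart_def)
    moreover have "w \<noteq> 0" using w(2) by auto
    ultimately obtain j where j: "j \<in> Basis" "(\<Sum>i\<in>Basis. (w \<bullet> i) * (?H j i \<bullet> N)) \<noteq> 0"
      using det_form_nonzero_imp_nondegenerate by blast
    \<comment> \<open>The first index of the form is the direction of the second differentiation, in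
      which \<open>?H j\<close> is linear, so summing over it assembles w.\<close>
    have "?H j w = (\<Sum>i\<in>Basis. (w \<bullet> i) *\<^sub>R ?H j i)"
      by (subst euclidean_representation[of w, symmetric]) (simp only: linear_sum[OF linH] linear_scale[OF linH])
    then have "?H j w \<bullet> N \<noteq> 0" using j(2) by (simp add: inner_sum_left)
    then have "\<omega> \<bullet> ?H j w \<noteq> 0" using t t0 by (simp add: inner_commute)
    with neg j(1) show False by blast
  qed
qed

theorem theorem3p4:
  fixes \<mu> :: "'a::euclidean_space measure"
    and M1 \<Gamma> M2 \<Omega> :: "'a set"
  assumes d3: "DIM('a) \<ge> 3"
    and k_le: "DIM('k::euclidean_space) \<le> (DIM('a) - 1) div 2"
    and hyp_dim: "DIM('m::euclidean_space) = DIM('a) - 1"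
    and M1: "smooth_submanifold TYPE('k) M1"
    and \<Gamma>: "openin (top_of_set M1) \<Gamma>" "\<Gamma> \<noteq> {}"
    and M2: "smooth_submanifold TYPE('m) M2"
    and \<Omega>: "openin (top_of_set M2) \<Omega>" "\<Omega> \<noteq> {}"
    and curv: "\<exists>p\<in>\<Omega>. nonzero_gauss_curvature_at TYPE('m) M2 p"
    and sets_\<mu>: "sets \<mu> = sets borel"
    and \<mu>_def: "\<forall>A\<in>sets borel. emeasure \<mu> A =
                   hausdorff_outer (real DIM('k)) (A \<inter> \<Gamma>) + hausdorff_outer (real DIM('m)) (A \<inter> \<Omega>)"
    and finite: "emeasure \<mu> (space \<mu>) < \<infinity>"
  shows "\<not> admits_fourier_frame \<mu>"
proof -
  let ?m = "DIM('m)"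
  interpret finite_measure \<mu>
    by (rule finite_measureI) (use finite in simp)
  obtain p where p: "p \<in> \<Gamma>" using \<Gamma>(2) by blast
  have "p \<in> M1" using p openin_imp_subset[OF \<Gamma>(1)] by blast
  then obtain \<phi>1 :: "'k \<Rightarrow> 'a" and U1 V1 where lp1: "p \<in> V1" "local_param \<phi>1 U1 V1 M1"
    using M1 unfolding smooth_submanifold_def by blast
  then obtain u1 where u1: "u1 \<in> U1" "\<phi>1 u1 = p"
    using \<open>p \<in> M1\<close> unfolding local_param_def by (metis IntI imageE)
  obtain c \<rho>0 where c: "c > 0" "\<rho>0 > 0"
    "\<And>\<rho>. 0 < \<rho> \<Longrightarrow> \<rho> \<le> \<rho>0 \<Longrightarrow> ennreal (c * \<rho> ^ DIM('k)) \<le> hausdorff_outer (real DIM('k)) (ball p \<rho> \<inter> \<Gamma>)"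
    using hausdorff_outer_lower_density[OF lp1(2) u1(1) \<Gamma>(1)] p unfolding u1(2) by metis
  \<comment> \<open>The contribution of \<open>\<Omega>\<close> only adds mass, so the lower density
    on \<open>\<Gamma>\<close> passes to \<open>\<mu>\<close>.\<close>
  have c': "c * \<rho> ^ DIM('k) \<le> measure \<mu> (ball p \<rho>)" if \<rho>: "0 < \<rho>" "\<rho> \<le> \<rho>0" for \<rho>
  proof -
    have "ennreal (c * \<rho> ^ DIM('k)) \<le> emeasure \<mu> (ball p \<rho>)"
      using c(3)[OF \<rho>] \<mu>_def by (simp add: add_increasing2)
    then show ?thesis by (simp add: emeasure_eq_measure)
  qed
  obtain p2 \<phi> U V u N where p2: "p2 \<in> \<Omega>" and lp: "local_param (\<phi> :: 'm \<Rightarrow> 'a) U V M2" and u: "u \<in> U" "\<phi> u = p2"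
    and N: "norm N = 1" "\<And>i. i \<in> Basis \<Longrightarrow> frechet_derivative \<phi> (at u) i \<bullet> N = 0"
    and K: "gauss_curvature_chart \<phi> u N \<noteq> 0"
    using curv unfolding nonzero_gauss_curvature_at_def by blast
  have U: "open U" "smooth_on U \<phi>" using lp by (auto simp: local_param_def)
  obtain \<delta>0 L where \<delta>0: "\<delta>0 > 0" and L: "L > 0" and im\<Omega>: "\<phi> ` cball u \<delta>0 \<subseteq> \<Omega>"
    and low: "\<And>x y. x \<in> cball u \<delta>0 \<Longrightarrow> y \<in> cball u \<delta>0 \<Longrightarrow> norm (x - y) \<le> L * norm (\<phi> x - \<phi> y)"
    by (rule local_param_bilipschitz[OF lp u(1) \<Omega>(1)]) (use p2 u(2) in \<open>blast+\<close>)
  obtain \<delta> g C where \<delta>: "\<delta> > 0" "\<delta> \<le> \<delta>0" "cball u \<delta> \<subseteq> U"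
    and g: "continuous_on UNIV g" "\<And>v. g v \<ge> 0" "\<And>v. v \<in> ball u \<delta> \<Longrightarrow> g v > 0"
      "\<And>v. v \<notin> ball u \<delta> \<Longrightarrow> g v = 0" and C: "C > 0"
    and decay: "\<And>\<eta>. norm \<eta> \<ge> 1 \<Longrightarrow>
      (cmod (\<integral>v. (if v \<in> ball u \<delta> then of_real (g v) * exp (- (\<i> * of_real (2 * pi * (\<eta> \<bullet> \<phi> v)))) else 0) \<partial>lborel))\<^sup>2
        \<le> C * norm \<eta> powr (- (3 * ?m / 4))"
    by (rule fourier_decay[OF U u(1) \<delta>0 curvature_nondegenerate[OF hyp_dim lp u(1) N K]]) (assumption+, rule that)
  \<comment> \<open>The chart is controlled only on \<open>U\<close>; cutting it off gives a Borel
    map on the whole space, and the value 0 outside the ball is harmless since \<open>g\<close>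
    vanishes there.\<close>
  define T where "T = (\<lambda>v. indicator (ball u \<delta>) v *\<^sub>R \<phi> v)"
  have "continuous_on (ball u \<delta>) \<phi>"
    by (rule continuous_on_subset[OF smooth_on_continuous_on[OF U(2)] order_trans[OF ball_subset_cball \<delta>(3)]])
  then have mT[measurable]: "T \<in> borel_measurable borel"
    unfolding T_def by (intro borel_measurable_continuous_on_indicator) auto
  have mg[measurable]: "g \<in> borel_measurable borel"
    using g(1) by (rule borel_measurable_continuous_onI)
  have intg: "integrable lborel g"
    by (rule integrable_lborel_compact_support[OF g(1) compact_cball[of u \<delta>]]) (use g(4) in auto)
  obtain G where G: "G \<ge> 0" "\<And>v. g v \<le> G"
  proof -
    obtain G where G: "\<And>v. v \<in> cball u \<delta> \<Longrightarrow> norm (g v) \<le> G"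
      using compact_imp_bounded[OF compact_continuous_image[OF continuous_on_subset[OF g(1)] compact_cball[of u \<delta>]]]
      by (force simp: bounded_iff)
    have "g v \<le> max G 0" for v
    proof (cases "v \<in> cball u \<delta>")
      case True
      then show ?thesis using G[OF True] by simp
    next
      case False
      then show ?thesis using g(4)[of v] by simp
    qed
    then show ?thesis using that[of "max G 0"] by simp
  qed
  define \<nu> where "\<nu> = distr (density lborel (\<lambda>v. ennreal (g v))) borel T"
  \<comment> \<open>\<open>G\<close> bounds the weight, and (2L)^m is the loss in comparing Lebesgue
    with Hausdorff measure through the chart.\<close>
  define K' where "K' = G * (2 * L) ^ ?m"
  have K': "K' \<ge> 0" using G L by (simp add: K'_def)
  have \<nu>_le: "emeasure \<nu> A \<le> ennreal K' * emeasure \<mu> A" if "A \<in> sets \<mu>" for A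
  proof -
    have A[measurable]: "A \<in> sets borel" using that sets_\<mu> by simp
    define S where "S = ball u \<delta> \<inter> T -` A"
    have "T -` A \<in> sets borel" using measurable_sets[OF mT A] by simp
    then have S[measurable]: "S \<in> sets borel" unfolding S_def by auto
    have SC: "S \<subseteq> cball u \<delta>0" using \<delta> by (auto simp: S_def)
    have im: "\<phi> ` S \<subseteq> A \<inter> \<Omega>"
      using im\<Omega> SC by (auto simp: S_def T_def)
    have "ennreal (1 / (2 * L) ^ ?m) * emeasure lborel S \<le> hausdorff_outer (real ?m) (\<phi> ` S)"
      by (rule lborel_le_hausdorff_outer_image[OF L]) (use low SC in blast)
    also have "\<dots> \<le> hausdorff_outer (real ?m) (A \<inter> \<Omega>)" by (rule hausdorff_outer_mono[OF im])
    also have "\<dots> \<le> emeasure \<mu> A" using \<mu>_def A by (simp add: add_increasing)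
    finally have 1: "ennreal (1 / (2 * L) ^ ?m) * emeasure lborel S \<le> emeasure \<mu> A" .
    have "emeasure \<nu> A = (\<integral>\<^sup>+v. ennreal (g v) * indicator (T -` A) v \<partial>lborel)"
      unfolding \<nu>_def using \<open>T -` A \<in> sets borel\<close>
      by (subst emeasure_distr) (auto simp: emeasure_density)
    also have "\<dots> \<le> (\<integral>\<^sup>+v. ennreal G * indicator S v \<partial>lborel)"
    proof (rule nn_integral_mono)
      fix v
      show "ennreal (g v) * indicator (T -` A) v \<le> ennreal G * indicator S v"
        using g(4)[of v] G(2)[of v] by (cases "v \<in> ball u \<delta>") (auto simp: S_def indicator_def intro: ennreal_leI)
    qed
    also have "\<dots> = ennreal G * emeasure lborel S" by (simp add: nn_integral_cmult_indicator)
    also have "\<dots> = ennreal K' * (ennreal (1 / (2 * L) ^ ?m) * emeasure lborel S)"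
    proof -
      have "ennreal K' * ennreal (1 / (2 * L) ^ ?m) = ennreal G"
        using K' L G by (simp add: ennreal_mult[symmetric] K'_def)
      then show ?thesis by (simp add: mult.assoc[symmetric])
    qed
    also have "\<dots> \<le> ennreal K' * emeasure \<mu> A" using 1 by (rule mult_left_mono) simp
    finally show ?thesis .
  qed
  have "sets \<nu> = sets \<mu>" by (simp add: \<nu>_def sets_\<mu>)
  then obtain h where h: "h \<in> borel_measurable \<mu>" "\<And>x. 0 \<le> h x" "\<And>x. h x \<le> K'"
    and dens: "density \<mu> (\<lambda>x. ennreal (h x)) = \<nu>"
    using bounded_density_exists[OF _ K' \<nu>_le] by metis
  note push = integral_pushforward_density[OF sets_\<mu> mT mg g(2) h(1,2) dens[unfolded \<nu>_def]]
  show ?thesis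
  proof (rule no_fourier_frame_if_decaying_density[OF finite_measure_axioms sets_\<mu> h(1), where K = K' and s = "3 * ?m / 4" and D = C and k = "DIM('k)" and p = p and c = c and \<epsilon> = \<rho>0])
    show "\<bar>h x\<bar> \<le> K'" for x using h by simp
    have "(\<integral>x. h x \<partial>\<mu>) = (\<integral>v. g v \<partial>lborel)" using push[of "\<lambda>_. 1 :: real"] by simp
    moreover have "(\<integral>v. g v \<partial>lborel) \<noteq> 0"
    proof
      assume "(\<integral>v. g v \<partial>lborel) = 0"
      then have "AE v in lborel. g v = 0"
        using integral_nonneg_eq_0_iff_AE[OF intg] g(2) by simp
      then have "AE v in lborel. v \<notin> ball u \<delta>"
        by eventually_elim (use g(3) in force)
      then have "emeasure lborel (ball u \<delta>) = 0"
        by (subst (asm) AE_iff_measurable[of "ball u \<delta>"]) auto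
      moreover have "unit_ball_vol ?m * \<delta> ^ ?m > 0" using \<delta>(1) by simp
      ultimately show False using \<delta>(1) by (simp add: emeasure_ball)
    qed
    ultimately show "(\<integral>x. h x \<partial>\<mu>) \<noteq> 0" by simp
    \<comment> \<open>The integer division in the hypothesis yields 2k \<le> m, and positivity of k
      makes the comparison with 3m/4 strict.\<close>
    have "2 * DIM('k) \<le> ?m" using k_le hyp_dim by linarith
    then show "3 * ?m / 4 > real DIM('k)" using DIM_positive[where 'a='k] by linarith
    show "DIM('k) < DIM('a)" using k_le d3 by linarith
    fix \<eta> :: 'a assume \<eta>: "norm \<eta> \<ge> 1"
    have "(\<integral>x. of_real (h x) * exp (- (\<i> * of_real (2 * pi * (\<eta> \<bullet> x)))) \<partial>\<mu>)
       = (\<integral>v. g v *\<^sub>R exp (- (\<i> * of_real (2 * pi * (\<eta> \<bullet> T v)))) \<partial>lborel)"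
      unfolding scaleR_conv_of_real[symmetric]
      by (rule push) (intro borel_measurable_continuous_onI continuous_intros)
    also have "\<dots> = (\<integral>v. (if v \<in> ball u \<delta> then of_real (g v) * exp (- (\<i> * of_real (2 * pi * (\<eta> \<bullet> \<phi> v)))) else 0) \<partial>lborel)"
      by (rule Bochner_Integration.integral_cong) (use g(4) in \<open>auto simp: T_def scaleR_conv_of_real\<close>)
    finally show "(cmod (\<integral>x. of_real (h x) * exp (- (\<i> * of_real (2 * pi * (\<eta> \<bullet> x)))) \<partial>\<mu>))\<^sup>2 \<le> C * norm \<eta> powr (- (3 * ?m / 4))"
      using decay[OF \<eta>] by simp
  qed (use C c c' in auto)
qed

end
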